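(* Let $H<G$ be groups and $K$ a sofic group. Suppose $H<G$ is relatively sofic over $K$. Then $\ast_H G$ is sofic.
   Context: $H<G$ is relatively sofic over a group $K$ if there exist a sequence of inclusions of groups $(H_i<G_i)_{i\in\mathbb N}$ with all $G_i$ sofic and all $H_i$ amenable, a free ultrafilter $\omega$ on $\mathbb N$, and an embedding $\pi:G\to\prod_\omega(G_i\times K)$ into the algebraic ultraproduct such that $\pi(G)\cap\prod_\omega(H_i\times K)=\pi(H)$. The algebraic ultraproduct is $\prod_\omega L_i=(\prod_i L_i)/N$ with $N=\{(g_i):\{i:g_i=1\}\in\omega\}$. $\ast_H G$ denotes the amalgamated free product of countably infinitely many copies of $G$ over the common subgroup $H$. *)

theory Defs
  imports Complex_Main "HOL-Algebra.Coset" "HOL-Combinatorics.Permutations"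
begin

definition hamming :: "nat \<Rightarrow> (nat \<Rightarrow> nat) \<Rightarrow> (nat \<Rightarrow> nat) \<Rightarrow> real" where
  "hamming n s t = real (card {i. i < n \<and> s i \<noteq> t i}) / real n"

definition sofic :: "('g, 'a) monoid_scheme \<Rightarrow> bool" where
  "sofic G \<longleftrightarrow> group G \<and>
    (\<forall>F. F \<subseteq> carrier G \<and> finite F \<longrightarrow> (\<forall>\<epsilon>::real. \<epsilon> > 0 \<longrightarrow>
      (\<exists>n::nat. n > 0 \<and> (\<exists>\<phi> :: 'g \<Rightarrow> nat \<Rightarrow> nat.
         (\<forall>g\<in>carrier G. \<phi> g permutes {..<n}) \<and>
         (\<forall>g\<in>F. \<forall>h\<in>F. hamming n (\<phi> (g \<otimes>\<^bsub>G\<^esub> h)) (\<phi> g \<circ> \<phi> h) < \<epsilon>) \<and>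
         (\<forall>g\<in>F. g \<noteq> \<one>\<^bsub>G\<^esub> \<longrightarrow> hamming n (\<phi> g) id > 1 - \<epsilon>)))))"

definition amenable :: "('g, 'a) monoid_scheme \<Rightarrow> bool" where
  "amenable G \<longleftrightarrow> group G \<and>
    (\<forall>F. F \<subseteq> carrier G \<and> finite F \<longrightarrow> (\<forall>\<epsilon>::real. \<epsilon> > 0 \<longrightarrow>
      (\<exists>A. A \<subseteq> carrier G \<and> finite A \<and> A \<noteq> {} \<and>
         (\<forall>g\<in>F. real (card (((g <#\<^bsub>G\<^esub> A) - A) \<union> (A - (g <#\<^bsub>G\<^esub> A))))
                   < \<epsilon> * real (card A)))))"

definition free_ultrafilter :: "nat set set \<Rightarrow> bool" where
  "free_ultrafilter \<omega> \<longleftrightarrow>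
     UNIV \<in> \<omega> \<and> {} \<notin> \<omega> \<and>
     (\<forall>A B. A \<in> \<omega> \<and> A \<subseteq> B \<longrightarrow> B \<in> \<omega>) \<and>
     (\<forall>A B. A \<in> \<omega> \<and> B \<in> \<omega> \<longrightarrow> A \<inter> B \<in> \<omega>) \<and>
     (\<forall>A. A \<in> \<omega> \<or> - A \<in> \<omega>) \<and>
     (\<forall>A. finite A \<longrightarrow> A \<notin> \<omega>)"

definition ProdGroups :: "(nat \<Rightarrow> ('x, 'b) monoid_scheme) \<Rightarrow> (nat \<Rightarrow> 'x) monoid" where
  "ProdGroups L = \<lparr> carrier = {f. \<forall>i. f i \<in> carrier (L i)},
                    Group.monoid.mult = (\<lambda>f g i. f i \<otimes>\<^bsub>L i\<^esub> g i),
                    one = (\<lambda>i. \<one>\<^bsub>L i\<^esub>) \<rparr>"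

definition ultra_kernel :: "nat set set \<Rightarrow> (nat \<Rightarrow> ('x, 'b) monoid_scheme) \<Rightarrow> (nat \<Rightarrow> 'x) set" where
  "ultra_kernel \<omega> L = {f \<in> carrier (ProdGroups L). {i. f i = \<one>\<^bsub>L i\<^esub>} \<in> \<omega>}"

definition ultraproduct :: "nat set set \<Rightarrow> (nat \<Rightarrow> ('x, 'b) monoid_scheme) \<Rightarrow> ((nat \<Rightarrow> 'x) set) monoid" where
  "ultraproduct \<omega> L = ProdGroups L Mod ultra_kernel \<omega> L"

definition ultra_sub :: "nat set set \<Rightarrow> (nat \<Rightarrow> ('x, 'b) monoid_scheme) \<Rightarrow> (nat \<Rightarrow> 'x set) \<Rightarrow> ((nat \<Rightarrow> 'x) set) set" where
  "ultra_sub \<omega> L S = {ultra_kernel \<omega> L #>\<^bsub>ProdGroups L\<^esub> f | f. \<forall>i. f i \<in> S i}"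

text \<open>The witnessing groups G_i live on a type 'x, given through the itself argument;
  the theorem is universally quantified over this type.\<close>
definition relatively_sofic_over ::
  "'x itself \<Rightarrow> ('g, 'a) monoid_scheme \<Rightarrow> 'g set \<Rightarrow> ('k, 'c) monoid_scheme \<Rightarrow> bool" where
  "relatively_sofic_over _ G H K \<longleftrightarrow>
    (\<exists>(Gs :: nat \<Rightarrow> 'x monoid) (Hs :: nat \<Rightarrow> 'x set) \<omega> \<pi>.
       (\<forall>i. sofic (Gs i) \<and> subgroup (Hs i) (Gs i) \<and> amenable ((Gs i)\<lparr>carrier := Hs i\<rparr>)) \<and>
       free_ultrafilter \<omega> \<and>
       \<pi> \<in> hom G (ultraproduct \<omega> (\<lambda>i. Gs i \<times>\<times> K)) \<and> inj_on \<pi> (carrier G) \<and>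
       \<pi> ` carrier G \<inter> ultra_sub \<omega> (\<lambda>i. Gs i \<times>\<times> K) (\<lambda>i. Hs i \<times> carrier K) = \<pi> ` H)"

text \<open>Presentation: words in letters (n, g) (g in the n-th copy of G), modulo the
  congruence generated by the multiplication table of each copy, deletion of the
  identity of each copy, and identification of h in copy n with h in copy m for h in H.\<close>
inductive_set amalg_rel :: "('g, 'a) monoid_scheme \<Rightarrow> 'g set \<Rightarrow> ((nat \<times> 'g) list \<times> (nat \<times> 'g) list) set"
  for G H where
  refl: "w \<in> lists (UNIV \<times> carrier G) \<Longrightarrow> (w, w) \<in> amalg_rel G H"
| sym: "(u, v) \<in> amalg_rel G H \<Longrightarrow> (v, u) \<in> amalg_rel G H"
| trans: "(u, v) \<in> amalg_rel G H \<Longrightarrow> (v, w) \<in> amalg_rel G H \<Longrightarrow> (u, w) \<in> amalg_rel G H"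
| mult: "g \<in> carrier G \<Longrightarrow> h \<in> carrier G \<Longrightarrow> ([(n, g), (n, h)], [(n, g \<otimes>\<^bsub>G\<^esub> h)]) \<in> amalg_rel G H"
| one: "([(n, \<one>\<^bsub>G\<^esub>)], []) \<in> amalg_rel G H"
| amalg: "h \<in> H \<Longrightarrow> h \<in> carrier G \<Longrightarrow> ([(n, h)], [(m, h)]) \<in> amalg_rel G H"
| ctx: "(u, v) \<in> amalg_rel G H \<Longrightarrow> xs \<in> lists (UNIV \<times> carrier G) \<Longrightarrow> ys \<in> lists (UNIV \<times> carrier G)
        \<Longrightarrow> (xs @ u @ ys, xs @ v @ ys) \<in> amalg_rel G H"

definition amalg_free_product :: "('g, 'a) monoid_scheme \<Rightarrow> 'g set \<Rightarrow> ((nat \<times> 'g) list set) monoid" where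
  "amalg_free_product G H =
     \<lparr> carrier = lists (UNIV \<times> carrier G) // amalg_rel G H,
       Group.monoid.mult = (\<lambda>A B. amalg_rel G H `` {(SOME a. a \<in> A) @ (SOME b. b \<in> B)}),
       one = amalg_rel G H `` {[]} \<rparr>"

end

theory Submission
  imports Defs
begin

text \<open>
  Call a sofic approximation of \<open>G\<close> on a finite set \<open>Z\<close> \<^emph>\<open>relative\<close> to \<open>H\<close> if \<open>Z\<close> carries a
  colouring that elements of \<open>H\<close> almost preserve and all other elements almost nowhere preserve.

  If \<open>H\<close> is amenable and \<open>B\<close> is the inverse of a Foelner set of \<open>H\<close>, colour \<open>s\<close> by the minimum of
  \<open>B s\<close> in a random ordering of \<open>Z\<close>. The minima over \<open>B s\<close> and \<open>B h s\<close> agree with probability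
  \<open>|B \<inter> B h| / |B \<union> B h|\<close>, which is close to \<open>1\<close>, while \<open>B s\<close> and \<open>B g s\<close> are disjoint
  for \<open>g \<notin> H\<close>. Relative approximations survive products with a sofic group and passage to
  subgroups of ultraproducts.

  Given a relative approximation with colouring \<open>c\<close>, let \<open>Q\<close> be a finite set on which a
  free product of copies of \<open>Z/2\<close>, with generators \<open>x(n, a)\<close> indexed by copies \<open>n\<close> and colours
  \<open>a\<close>, acts in such a way that no nonempty reduced word of length at most \<open>L\<close> has a fixed point
  (all permutations of the ball of radius \<open>L\<close>). The element \<open>g\<close> of the \<open>n\<close>-th copy of \<open>G\<close> acts on \<open>Z \<times> Q\<close> by
  \<open>(s, q) \<mapsto> (g s, x(n, c (g s)) x(n, c s) q)\<close>. On \<open>H\<close> this almost does not depend on \<open>n\<close>, and a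
  reduced word of the amalgamated product yields a reduced word in the generators, hence it
  moves almost every point.
\<close>

section \<open>Properties that hold on most points of a finite set\<close>

definition mostly :: "'a set \<Rightarrow> real \<Rightarrow> ('a \<Rightarrow> bool) \<Rightarrow> bool" where
  "mostly Z e P \<longleftrightarrow> real (card {z \<in> Z. \<not> P z}) \<le> e * real (card Z)"

lemma mostly_mono:
  assumes "mostly Z e P" "finite Z" "\<And>z. z \<in> Z \<Longrightarrow> P z \<Longrightarrow> Q z" "e \<le> e'"
  shows "mostly Z e' Q"
proof -
  have "card {z \<in> Z. \<not> Q z} \<le> card {z \<in> Z. \<not> P z}"
    using assms by (intro card_mono) auto
  moreover have "e * real (card Z) \<le> e' * real (card Z)"
    using assms by (intro mult_right_mono) auto
  ultimately show ?thesis
    using assms(1) unfolding mostly_def by linarith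
qed

lemma mostly_conj:
  assumes "mostly Z e P" "mostly Z e' Q" "finite Z"
  shows "mostly Z (e + e') (\<lambda>z. P z \<and> Q z)"
proof -
  have "{z \<in> Z. \<not> (P z \<and> Q z)} = {z \<in> Z. \<not> P z} \<union> {z \<in> Z. \<not> Q z}" by auto
  then have "card {z \<in> Z. \<not> (P z \<and> Q z)} \<le> card {z \<in> Z. \<not> P z} + card {z \<in> Z. \<not> Q z}"
    by (simp add: card_Un_le)
  then show ?thesis
    using assms unfolding mostly_def by (simp add: algebra_simps)
qed

lemma mostly_ball:
  assumes "finite F" "finite Z" "\<And>x. x \<in> F \<Longrightarrow> mostly Z e (P x)"
  shows "mostly Z (real (card F) * e) (\<lambda>z. \<forall>x\<in>F. P x z)"
  using assms(1,3)
proof (induction F)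
  case empty
  then show ?case by (simp add: mostly_def)
next
  case (insert x F)
  then have "mostly Z (e + real (card F) * e) (\<lambda>z. P x z \<and> (\<forall>x\<in>F. P x z))"
    using assms(2) by (intro mostly_conj) auto
  then show ?case
    using insert.hyps by (simp add: algebra_simps)
qed

lemma mostly_bij:
  assumes "mostly Z e P" "bij_betw f Z Z"
  shows "mostly Z e (\<lambda>z. P (f z))"
proof -
  have "bij_betw f {z \<in> Z. \<not> P (f z)} {z \<in> Z. \<not> P z}"
    using assms(2) by (auto simp: bij_betw_def inj_on_def)
  then show ?thesis
    using assms(1) by (simp add: mostly_def bij_betw_same_card)
qed

lemma mostly_Times_fst:
  assumes "mostly Z e P"
  shows "mostly (Z \<times> Y) e (\<lambda>z. P (fst z))"
proof -
  have "{z \<in> Z \<times> Y. \<not> P (fst z)} = {z \<in> Z. \<not> P z} \<times> Y" by auto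
  moreover have "real (card {z \<in> Z. \<not> P z}) * real (card Y) \<le> e * real (card Z) * real (card Y)"
    using assms by (intro mult_right_mono) (auto simp: mostly_def)
  ultimately show ?thesis
    by (simp add: mostly_def card_cartesian_product)
qed

lemma mostly_Times_snd:
  assumes "mostly Y e P"
  shows "mostly (Z \<times> Y) e (\<lambda>z. P (snd z))"
proof -
  have "{z \<in> Z \<times> Y. \<not> P (snd z)} = Z \<times> {z \<in> Y. \<not> P z}" by auto
  moreover have "real (card Z) * real (card {z \<in> Y. \<not> P z}) \<le> real (card Z) * (e * real (card Y))"
    using assms by (intro mult_left_mono) (auto simp: mostly_def)
  ultimately show ?thesis
    by (simp add: mostly_def card_cartesian_product mult_ac)
qed

section \<open>Soficity in terms of exceptional sets\<close>

lemma hamming_mostly: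
  assumes "n > 0" "mostly {..<n} e (\<lambda>i. s i = t i)"
  shows "hamming n s t \<le> e"
  using assms by (simp add: hamming_def mostly_def divide_le_eq)

lemma mostly_hamming:
  assumes "n > 0" "hamming n s t \<le> e"
  shows "mostly {..<n} e (\<lambda>i. s i = t i)"
  using assms by (simp add: hamming_def mostly_def divide_le_eq)

lemma card_filter_not:
  assumes "finite Z"
  shows "real (card {z \<in> Z. \<not> P z}) = real (card Z) - real (card {z \<in> Z. P z})"
proof -
  have "card Z = card {z \<in> Z. \<not> P z} + card {z \<in> Z. P z}"
    using assms by (subst card_Un_disjoint[symmetric]) (auto intro: arg_cong[where f = card])
  then show ?thesis by simp
qed

lemma hamming_id_mostly:
  assumes "n > 0" "mostly {..<n} e (\<lambda>i. s i \<noteq> i)"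
  shows "hamming n s id \<ge> 1 - e"
proof -
  have "real n - real (card {i. i < n \<and> s i \<noteq> i}) \<le> e * real n"
    using assms(2) card_filter_not[of "{..<n}" "\<lambda>i. s i \<noteq> i"] by (simp add: mostly_def)
  then show ?thesis
    using assms(1) by (simp add: hamming_def le_divide_eq algebra_simps)
qed

lemma mostly_hamming_id:
  assumes "n > 0" "hamming n s id \<ge> 1 - e"
  shows "mostly {..<n} e (\<lambda>i. s i \<noteq> i)"
proof -
  have "real n - real (card {i. i < n \<and> s i \<noteq> i}) \<le> e * real n"
    using assms by (simp add: hamming_def le_divide_eq algebra_simps)
  then show ?thesis
    using card_filter_not[of "{..<n}" "\<lambda>i. s i \<noteq> i"] by (simp add: mostly_def)
qed

text \<open>Soficity may be checked on any finite nonempty set in place of an initial segment of the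
  naturals: a bijection with \<open>{..<card Z}\<close> transports the maps and preserves
  proportions. The hypothesis is applied with \<open>e/2\<close>, because \<open>mostly\<close>
  gives non-strict bounds while the definition asks for strict ones.\<close>

lemma soficI:
  fixes G :: "('g, 'a) monoid_scheme"
  assumes "group G"
    and approx: "\<And>F e. finite F \<Longrightarrow> F \<subseteq> carrier G \<Longrightarrow> e > 0 \<Longrightarrow>
      \<exists>(Z :: 'z set) \<rho>. finite Z \<and> Z \<noteq> {} \<and> (\<forall>g\<in>carrier G. bij_betw (\<rho> g) Z Z) \<and>
        (\<forall>g\<in>F. \<forall>h\<in>F. mostly Z e (\<lambda>z. \<rho> (g \<otimes>\<^bsub>G\<^esub> h) z = \<rho> g (\<rho> h z))) \<and>
        (\<forall>g\<in>F. g \<noteq> \<one>\<^bsub>G\<^esub> \<longrightarrow> mostly Z e (\<lambda>z. \<rho> g z \<noteq> z))"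
  shows "sofic G"
  unfolding sofic_def
proof (intro conjI allI impI)
  show "group G" by fact
  fix F and e :: real
  assume F: "F \<subseteq> carrier G \<and> finite F" and e: "e > 0"
  obtain Z :: "'z set" and \<rho> where Z: "finite Z" "Z \<noteq> {}"
    and bij: "\<And>g. g \<in> carrier G \<Longrightarrow> bij_betw (\<rho> g) Z Z"
    and mult: "\<And>g h. g \<in> F \<Longrightarrow> h \<in> F \<Longrightarrow> mostly Z (e/2) (\<lambda>z. \<rho> (g \<otimes>\<^bsub>G\<^esub> h) z = \<rho> g (\<rho> h z))"
    and free: "\<And>g. g \<in> F \<Longrightarrow> g \<noteq> \<one>\<^bsub>G\<^esub> \<Longrightarrow> mostly Z (e/2) (\<lambda>z. \<rho> g z \<noteq> z)"
    using approx[of F "e/2", OF conjunct2[OF F] conjunct1[OF F] half_gt_zero[OF e]] by blast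
  obtain b where b: "bij_betw b {..<card Z} Z"
    using ex_bij_betw_nat_finite[OF Z(1)] by (auto simp: atLeast0LessThan)
  define n where "n = card Z"
  have n: "n > 0" using Z by (simp add: n_def card_gt_0_iff)
  define b' where "b' = inv_into {..<n} b"
  have b': "bij_betw b' Z {..<n}"
    using b by (simp add: b'_def n_def bij_betw_inv_into)
  have bZ: "b i \<in> Z" if "i < n" for i
    using b that by (auto simp: bij_betw_def n_def)
  have b'n: "b' z < n" if "z \<in> Z" for z
    using b' that by (auto simp: bij_betw_def)
  have bb': "b (b' z) = z" if "z \<in> Z" for z
    using b that by (auto simp: b'_def n_def bij_betw_inv_into_right)
  have b'b: "b' (b i) = i" if "i < n" for i
    using b that by (auto simp: b'_def n_def bij_betw_inv_into_left)
  have \<rho>Z: "\<rho> g z \<in> Z" if "g \<in> carrier G" "z \<in> Z" for g z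
    using bij[OF that(1)] that(2) by (auto simp: bij_betw_def)
  have tr: "mostly {..<n} d (\<lambda>i. P (b i))" if "mostly Z d P" for d P
  proof -
    have "bij_betw b {i \<in> {..<n}. \<not> P (b i)} {z \<in> Z. \<not> P z}"
      using b unfolding n_def bij_betw_def inj_on_def by auto
    then show ?thesis
      using that by (simp add: mostly_def bij_betw_same_card n_def)
  qed
  \<comment> \<open>Outside \<open>{..<n}\<close> the conjugated map is the identity, as
    \<open>permutes\<close> demands.\<close>
  define \<phi> where "\<phi> g i = (if i < n then b' (\<rho> g (b i)) else i)" for g i
  have perm: "\<phi> g permutes {..<n}" if g: "g \<in> carrier G" for g
  proof (rule bij_imp_permutes)
    have "bij_betw (b' \<circ> (\<rho> g \<circ> b)) {..<n} {..<n}"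
      using bij_betw_trans[OF bij_betw_trans[OF b bij[OF g]] b'] by (simp add: n_def comp_assoc)
    then show "bij_betw (\<phi> g) {..<n} {..<n}"
      by (rule bij_betw_cong[THEN iffD1, rotated]) (auto simp: \<phi>_def)
  qed (simp add: \<phi>_def)
  have "hamming n (\<phi> (g \<otimes>\<^bsub>G\<^esub> h)) (\<phi> g \<circ> \<phi> h) < e" if "g \<in> F" "h \<in> F" for g h
  proof -
    have "mostly {..<n} (e/2) (\<lambda>i. \<phi> (g \<otimes>\<^bsub>G\<^esub> h) i = (\<phi> g \<circ> \<phi> h) i)"
      by (rule mostly_mono[OF tr[OF mult[OF that]]])
         (use that F in \<open>auto simp: \<phi>_def bb' bZ b'n \<rho>Z subset_iff\<close>)
    from hamming_mostly[OF n this] show ?thesis using e by (simp add: comp_def)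
  qed
  moreover have "hamming n (\<phi> g) id > 1 - e" if "g \<in> F" "g \<noteq> \<one>\<^bsub>G\<^esub>" for g
  proof -
    have "mostly {..<n} (e/2) (\<lambda>i. \<phi> g i \<noteq> i)"
      by (rule mostly_mono[OF tr[OF free[OF that]]])
         (use that F bZ bb' \<rho>Z in \<open>auto simp: \<phi>_def subset_iff, metis\<close>)
    from hamming_id_mostly[OF n this] show ?thesis using e by simp
  qed
  ultimately show "\<exists>n>0. \<exists>\<phi>. (\<forall>g\<in>carrier G. \<phi> g permutes {..<n}) \<and>
         (\<forall>g\<in>F. \<forall>h\<in>F. hamming n (\<phi> (g \<otimes>\<^bsub>G\<^esub> h)) (\<phi> g \<circ> \<phi> h) < e) \<and>
         (\<forall>g\<in>F. g \<noteq> \<one>\<^bsub>G\<^esub> \<longrightarrow> hamming n (\<phi> g) id > 1 - e)"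
    using n perm by blast
qed

text \<open>The definition bounds each product and each fixed-point set separately. A union bound
  over these finitely many conditions yields points at which all of them hold
  simultaneously.\<close>

lemma soficE:
  assumes "sofic G" "finite M" "M \<subseteq> carrier G" "e > 0"
  obtains n :: nat and \<phi> where "n > 0" "\<And>g. g \<in> carrier G \<Longrightarrow> \<phi> g permutes {..<n}"
    "mostly {..<n} e (\<lambda>s. (\<forall>g\<in>M. \<forall>h\<in>M. \<phi> (g \<otimes>\<^bsub>G\<^esub> h) s = \<phi> g (\<phi> h s)) \<and>
        (\<forall>g\<in>M. g \<noteq> \<one>\<^bsub>G\<^esub> \<longrightarrow> \<phi> g s \<noteq> s))"
proof -
  \<comment> \<open>The number of conditions to be combined, increased by one so that it is positive
    even for empty \<open>M\<close>.\<close>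
  define k where "k = 1 + card (M \<times> M) + card M"
  define d where "d = e / real k"
  have "k > 0" by (simp add: k_def)
  then have d: "d > 0" and kd: "real k * d = e" using assms by (simp_all add: d_def)
  obtain n \<phi> where n: "n > 0" and perm: "\<And>g. g \<in> carrier G \<Longrightarrow> \<phi> g permutes {..<n}"
    and mult: "\<And>g h. g \<in> M \<Longrightarrow> h \<in> M \<Longrightarrow> hamming n (\<phi> (g \<otimes>\<^bsub>G\<^esub> h)) (\<phi> g \<circ> \<phi> h) < d"
    and free: "\<And>g. g \<in> M \<Longrightarrow> g \<noteq> \<one>\<^bsub>G\<^esub> \<Longrightarrow> hamming n (\<phi> g) id > 1 - d"
    using assms(1)[unfolded sofic_def, THEN conjunct2, THEN spec, THEN mp, OF conjI[OF assms(3,2)],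
        THEN spec, THEN mp, OF d] by blast
  have 1: "mostly {..<n} (real (card (M \<times> M)) * d)
      (\<lambda>s. \<forall>p\<in>M \<times> M. \<phi> (fst p \<otimes>\<^bsub>G\<^esub> snd p) s = \<phi> (fst p) (\<phi> (snd p) s))"
    using mostly_hamming[OF n less_imp_le[OF mult]] assms by (intro mostly_ball) auto
  have 2: "mostly {..<n} (real (card M) * d) (\<lambda>s. \<forall>g\<in>M. g \<noteq> \<one>\<^bsub>G\<^esub> \<longrightarrow> \<phi> g s \<noteq> s)"
  proof (intro mostly_ball)
    fix g assume "g \<in> M"
    then show "mostly {..<n} d (\<lambda>s. g \<noteq> \<one>\<^bsub>G\<^esub> \<longrightarrow> \<phi> g s \<noteq> s)"
      using mostly_hamming_id[OF n less_imp_le[OF free]] d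
      by (cases "g = \<one>\<^bsub>G\<^esub>") (auto simp: mostly_def)
  qed (use assms in auto)
  have "real (card (M \<times> M)) * d + real (card M) * d \<le> e"
    using d by (simp flip: kd add: k_def algebra_simps)
  with mostly_mono[OF mostly_conj[OF 1 2]]
  have "mostly {..<n} e (\<lambda>s. (\<forall>g\<in>M. \<forall>h\<in>M. \<phi> (g \<otimes>\<^bsub>G\<^esub> h) s = \<phi> g (\<phi> h s)) \<and>
        (\<forall>g\<in>M. g \<noteq> \<one>\<^bsub>G\<^esub> \<longrightarrow> \<phi> g s \<noteq> s))"
    by simp
  then show ?thesis using that n perm by blast
qed

section \<open>Sofic approximations relative to a subgroup\<close>

definition good_point ::
  "('g, 'a) monoid_scheme \<Rightarrow> 'g set \<Rightarrow> 'g set \<Rightarrow> ('g \<Rightarrow> 'z \<Rightarrow> 'z) \<Rightarrow> ('z \<Rightarrow> nat) \<Rightarrow> 'z \<Rightarrow> bool" where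
  "good_point G H F \<phi> c s \<longleftrightarrow>
    (\<forall>g\<in>F. \<forall>h\<in>F. \<phi> (g \<otimes>\<^bsub>G\<^esub> h) s = \<phi> g (\<phi> h s)) \<and>
    (\<forall>g\<in>F. g \<noteq> \<one>\<^bsub>G\<^esub> \<longrightarrow> \<phi> g s \<noteq> s) \<and>
    (\<forall>g\<in>F. c (\<phi> g s) = c s \<longleftrightarrow> g \<in> H)"

text \<open>All conditions are gathered at one point, so a single exceptional set serves all of
  \<open>F\<close>, and a trajectory is controlled by asking that each of its points be good. The
  maps are bijections for every element of the group, not only for those of \<open>F\<close>,
  because arbitrary words have to act.\<close>

definition rel_approx ::
  "('g, 'a) monoid_scheme \<Rightarrow> 'g set \<Rightarrow> 'g set \<Rightarrow> real \<Rightarrow> 'z set \<Rightarrow> ('g \<Rightarrow> 'z \<Rightarrow> 'z) \<Rightarrow> ('z \<Rightarrow> nat) \<Rightarrow> bool" where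
  "rel_approx G H F e Z \<phi> c \<longleftrightarrow>
    finite Z \<and> Z \<noteq> {} \<and> (\<forall>g\<in>carrier G. bij_betw (\<phi> g) Z Z) \<and> mostly Z e (good_point G H F \<phi> c)"

lemma rel_approx_mono:
  assumes "rel_approx G H F e Z \<phi> c" "F' \<subseteq> F"
  shows "rel_approx G H F' e Z \<phi> c"
proof -
  have "mostly Z e (good_point G H F' \<phi> c)"
    by (rule mostly_mono[where P = "good_point G H F \<phi> c" and e = e])
       (use assms in \<open>auto simp: rel_approx_def good_point_def subset_iff\<close>)
  then show ?thesis
    using assms(1) by (simp add: rel_approx_def)
qed

subsection \<open>A finite model of the free product of copies of \<open>Z/2\<close>\<close>

text \<open>Normal forms in the free product of copies of Z/2 indexed by \<open>X\<close>: this is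
  the ball of radius \<open>L\<close> about the identity in its Cayley graph.\<close>

definition words :: "'l set \<Rightarrow> nat \<Rightarrow> 'l list set" where
  "words X L = {w \<in> lists X. distinct_adj w \<and> length w \<le> L}"

text \<open>Left multiplication by the generator \<open>x\<close>, cut off at the boundary of the
  ball: a word of length \<open>L\<close> that would become longer stays fixed. This keeps the map
  an involution on a finite set, and it agrees with the free product as long as the boundary is not
  reached.\<close>

definition flip :: "'l set \<Rightarrow> nat \<Rightarrow> 'l \<Rightarrow> 'l list \<Rightarrow> 'l list" where
  "flip X L x w =
    (if w \<notin> words X L then w
     else if w \<noteq> [] \<and> hd w = x then tl w
     else if x \<in> X \<and> length w < L then x # w else w)"

lemma finite_words: "finite X \<Longrightarrow> finite (words X L)"
  by (rule finite_subset[OF _ finite_lists_length_le[of X L]]) (auto simp: words_def)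

lemma Nil_in_words [simp]: "[] \<in> words X L"
  by (simp add: words_def)

text \<open>Prepending and deleting \<open>x\<close> undo each other: in a reduced word starting
  with \<open>x\<close> the second letter differs from \<open>x\<close>, and its tail has length
  below \<open>L\<close>, so \<open>x\<close> can be put back.\<close>

lemma flip_flip: "flip X L x (flip X L x w) = w"
  by (cases w) (auto simp: flip_def words_def distinct_adj_Cons)

lemma flip_in_words: "w \<in> words X L \<Longrightarrow> flip X L x w \<in> words X L"
  by (cases w) (auto simp: flip_def words_def distinct_adj_Cons)

lemma flip_permutes: "flip X L x permutes words X L"
proof (rule bij_imp_permutes)
  show "bij_betw (flip X L x) (words X L) (words X L)"
    by (rule bij_betwI[where g = "flip X L x"]) (auto simp: flip_flip flip_in_words)
qed (simp add: flip_def)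

lemma flip_Cons:
  assumes "w \<in> words X L" "x \<in> X" "length w < L" "w = [] \<or> hd w \<noteq> x"
  shows "flip X L x w = x # w" "x # w \<in> words X L"
  using assms by (cases w; auto simp: flip_def words_def distinct_adj_Cons)+

subsection \<open>The action of words in the copies of \<open>G\<close>\<close>

text \<open>The second coordinate is a permutation of the ball rather than a point of it, and flips
  act by composition from the left. A composite different from the identity then moves every
  permutation, whereas it might fix many points of the ball. The flip at the old colour is there to
  cancel the last flip of a preceding letter from the same copy.\<close>

definition letter_act ::
  "('g \<Rightarrow> 'z \<Rightarrow> 'z) \<Rightarrow> ('z \<Rightarrow> nat) \<Rightarrow> (nat \<times> nat) set \<Rightarrow> nat \<Rightarrow> nat \<times> 'g \<Rightarrow>
    'z \<times> ((nat \<times> nat) list \<Rightarrow> (nat \<times> nat) list) \<Rightarrow> 'z \<times> ((nat \<times> nat) list \<Rightarrow> (nat \<times> nat) list)" where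
  "letter_act \<phi> c X L l z =
    (\<phi> (snd l) (fst z),
     flip X L (fst l, c (\<phi> (snd l) (fst z))) \<circ> flip X L (fst l, c (fst z)) \<circ> snd z)"

definition word_act where
  "word_act \<phi> c X L w = foldr (letter_act \<phi> c X L) w"

abbreviation act_space where
  "act_space Z X L \<equiv> Z \<times> {q. q permutes words X L}"

lemma word_act_Nil [simp]: "word_act \<phi> c X L [] z = z"
  by (simp add: word_act_def)

lemma word_act_Cons [simp]: "word_act \<phi> c X L (l # w) z = letter_act \<phi> c X L l (word_act \<phi> c X L w z)"
  by (simp add: word_act_def)

lemma word_act_append [simp]:
  "word_act \<phi> c X L (u @ v) z = word_act \<phi> c X L u (word_act \<phi> c X L v z)"
  by (simp add: word_act_def)

lemma finite_act_space: "finite Z \<Longrightarrow> finite X \<Longrightarrow> finite (act_space Z X L)"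
  by (simp add: finite_permutations finite_words)

lemma letter_act_bij:
  assumes "finite Z" "finite X" "bij_betw (\<phi> g) Z Z"
  shows "bij_betw (letter_act \<phi> c X L (n, g)) (act_space Z X L) (act_space Z X L)"
proof -
  let ?f = "letter_act \<phi> c X L (n, g)"
  have inj: "inj_on ?f (act_space Z X L)"
  proof (rule inj_onI)
    fix y z assume y: "y \<in> act_space Z X L" and z: "z \<in> act_space Z X L" and eq: "?f y = ?f z"
    then have 1: "fst y = fst z"
      using assms(3) by (auto simp: letter_act_def bij_betw_def inj_on_def)
    \<comment> \<open>Both flips depend only on the first coordinate, which is already known to
      agree. Applying them again in reverse order recovers the second coordinate.\<close>
    have "flip X L (n, c (fst z)) (flip X L (n, c (\<phi> g (fst z)))
        (flip X L (n, c (\<phi> g (fst z))) (flip X L (n, c (fst z)) (snd y w)))) =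
      flip X L (n, c (fst z)) (flip X L (n, c (\<phi> g (fst z)))
        (flip X L (n, c (\<phi> g (fst z))) (flip X L (n, c (fst z)) (snd z w))))" for w
      using eq 1 by (simp add: letter_act_def fun_eq_iff)
    then have "snd y = snd z"
      by (simp add: flip_flip fun_eq_iff)
    with 1 show "y = z" by (simp add: prod_eq_iff)
  qed
  have "?f ` act_space Z X L \<subseteq> act_space Z X L"
    using assms(3) by (auto simp: letter_act_def bij_betw_def intro!: permutes_compose flip_permutes)
  with inj show ?thesis
    using finite_act_space[OF assms(1,2)] by (simp add: bij_betw_def endo_inj_surj)
qed

lemma word_act_bij:
  assumes "finite Z" "finite X" "\<And>g. g \<in> carrier G \<Longrightarrow> bij_betw (\<phi> g) Z Z"
    "w \<in> lists (UNIV \<times> carrier G)"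
  shows "bij_betw (word_act \<phi> c X L w) (act_space Z X L) (act_space Z X L)"
  using assms(4)
proof (induction w)
  case Nil
  show ?case by (rule bij_betw_cong[THEN iffD1, OF _ bij_betw_id]) simp
next
  case (Cons l w)
  have "bij_betw (letter_act \<phi> c X L l) (act_space Z X L) (act_space Z X L)"
    using Cons.hyps by (cases l) (auto intro!: letter_act_bij assms)
  from bij_betw_trans[OF Cons.IH this] show ?case
    by (rule bij_betw_cong[THEN iffD1, rotated]) simp
qed

text \<open>Words act by bijections of the whole space, so the preimage of the bad points has the
  same size as the set of bad points. Hence each position of a trajectory costs only
  \<open>e\<close>, whatever word led to it.\<close>

lemma mostly_good_fst:
  fixes X :: "(nat \<times> nat) set"
  assumes "rel_approx G H F e Z \<phi> c" "finite X" "w \<in> lists (UNIV \<times> carrier G)"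
  shows "mostly (act_space Z X L) e (\<lambda>z. good_point G H F \<phi> c (fst (word_act \<phi> c X L w z)))"
proof -
  have "mostly (act_space Z X L) e (\<lambda>z. good_point G H F \<phi> c (fst z))"
    using assms(1) by (intro mostly_Times_fst) (simp add: rel_approx_def)
  then show ?thesis
    by (rule mostly_bij) (use assms in \<open>auto simp: rel_approx_def intro!: word_act_bij[where G = G]\<close>)
qed

lemma amalg_rel_lists:
  assumes "group G" "(u, v) \<in> amalg_rel G H"
  shows "u \<in> lists (UNIV \<times> carrier G) \<and> v \<in> lists (UNIV \<times> carrier G)"
proof -
  interpret group G by fact
  show ?thesis using assms(2) by induction auto
qed

text \<open>Induction on the derivation: each elementary relation holds at good points, transitivity
  adds the errors, and a context on the right is a bijective change of the starting point. The set
  \<open>F\<close> and the factor \<open>k\<close> depend only on the derivation, so they can be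
  fixed before an approximation is chosen.\<close>

lemma amalg_rel_act:
  fixes G :: "('g, 'a) monoid_scheme" and H :: "'g set"
  assumes "group G" "(u, v) \<in> amalg_rel G H"
  shows "\<exists>F k. finite F \<and> F \<subseteq> carrier G \<and> k \<ge> 0 \<and>
    (\<forall>(Z :: 'z set) \<phi> c X L e. rel_approx G H F e Z \<phi> c \<longrightarrow> finite X \<longrightarrow>
       mostly (act_space Z X L) (k * e) (\<lambda>z. word_act \<phi> c X L u z = word_act \<phi> c X L v z))"
  using assms(2)
proof induction
  case (refl w)
  show ?case by (rule exI[of _ "{}"], rule exI[of _ 0]) (auto simp: mostly_def)
next
  case (sym u v)
  then show ?case
    by (simp only: eq_commute[of "word_act \<phi> c X L v z" for \<phi> c X L z])
next
  case (trans u v w)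
  obtain F k where 1: "finite F" "F \<subseteq> carrier G" "k \<ge> 0"
    "\<And>(Z :: 'z set) \<phi> c X L e. rel_approx G H F e Z \<phi> c \<Longrightarrow> finite X \<Longrightarrow>
       mostly (act_space Z X L) (k * e) (\<lambda>z. word_act \<phi> c X L u z = word_act \<phi> c X L v z)"
    using trans.IH(1) by blast
  obtain F' k' where 2: "finite F'" "F' \<subseteq> carrier G" "k' \<ge> 0"
    "\<And>(Z :: 'z set) \<phi> c X L e. rel_approx G H F' e Z \<phi> c \<Longrightarrow> finite X \<Longrightarrow>
       mostly (act_space Z X L) (k' * e) (\<lambda>z. word_act \<phi> c X L v z = word_act \<phi> c X L w z)"
    using trans.IH(2) by blast
  show ?case
  proof (intro exI[of _ "F \<union> F'"] exI[of _ "k + k'"] conjI allI impI)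
    fix Z :: "'z set" and \<phi> c L e and X :: "(nat \<times> nat) set"
    assume a: "rel_approx G H (F \<union> F') e Z \<phi> c" "finite X"
    then have fin: "finite (act_space Z X L)"
      by (intro finite_act_space) (auto simp: rel_approx_def)
    have "mostly (act_space Z X L) (k * e + k' * e)
      (\<lambda>z. word_act \<phi> c X L u z = word_act \<phi> c X L v z \<and> word_act \<phi> c X L v z = word_act \<phi> c X L w z)"
      by (intro mostly_conj 1 2 rel_approx_mono[OF a(1)] fin a) auto
    then show "mostly (act_space Z X L) ((k + k') * e) (\<lambda>z. word_act \<phi> c X L u z = word_act \<phi> c X L w z)"
      by (rule mostly_mono) (use fin in \<open>auto simp: algebra_simps\<close>)
  qed (use 1 2 in auto)
next
  case (mult g h n)
  interpret group G by fact
  show ?case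
  proof (intro exI[of _ "{g, h}"] exI[of _ 1] conjI allI impI)
    fix Z :: "'z set" and \<phi> c L e and X :: "(nat \<times> nat) set"
    assume a: "rel_approx G H {g, h} e Z \<phi> c" "finite X"
    have "mostly (act_space Z X L) e (\<lambda>z. good_point G H {g, h} \<phi> c (fst z))"
      using mostly_good_fst[OF a, of "[]"] by simp
    \<comment> \<open>At a good point the first coordinates agree, and the two middle flips, both at
      the colour reached after \<open>h\<close>, cancel.\<close>
    then show "mostly (act_space Z X L) (1 * e)
        (\<lambda>z. word_act \<phi> c X L [(n, g), (n, h)] z = word_act \<phi> c X L [(n, g \<otimes>\<^bsub>G\<^esub> h)] z)"
      by (rule mostly_mono)
         (use a finite_act_space[of Z X] in \<open>auto simp: good_point_def letter_act_def flip_flip fun_eq_iff rel_approx_def\<close>)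
  qed (use mult in auto)
next
  case (one n)
  interpret group G by fact
  show ?case
  proof (intro exI[of _ "{\<one>\<^bsub>G\<^esub>}"] exI[of _ 1] conjI allI impI)
    fix Z :: "'z set" and \<phi> c L e and X :: "(nat \<times> nat) set"
    assume a: "rel_approx G H {\<one>\<^bsub>G\<^esub>} e Z \<phi> c" "finite X"
    have bij: "bij_betw (\<phi> \<one>\<^bsub>G\<^esub>) Z Z"
      using a by (simp add: rel_approx_def)
    have "mostly (act_space Z X L) e (\<lambda>z. good_point G H {\<one>\<^bsub>G\<^esub>} \<phi> c (fst z))"
      using mostly_good_fst[OF a, of "[]"] by simp
    then show "mostly (act_space Z X L) (1 * e) (\<lambda>z. word_act \<phi> c X L [(n, \<one>\<^bsub>G\<^esub>)] z = word_act \<phi> c X L [] z)"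
    proof (rule mostly_mono)
      fix z assume z: "z \<in> act_space Z X L" and good: "good_point G H {\<one>\<^bsub>G\<^esub>} \<phi> c (fst z)"
      \<comment> \<open>Multiplicativity makes the map of the identity idempotent at a good point;
        injectivity turns this into a fixed point.\<close>
      have "\<phi> \<one>\<^bsub>G\<^esub> (fst z) = \<phi> \<one>\<^bsub>G\<^esub> (\<phi> \<one>\<^bsub>G\<^esub> (fst z))"
        using good by (simp add: good_point_def)
      then have "\<phi> \<one>\<^bsub>G\<^esub> (fst z) = fst z"
        using inj_onD[OF bij_betw_imp_inj_on[OF bij], of "\<phi> \<one>\<^bsub>G\<^esub> (fst z)" "fst z"]
          bij_betwE[OF bij] z by auto
      then show "word_act \<phi> c X L [(n, \<one>\<^bsub>G\<^esub>)] z = word_act \<phi> c X L [] z"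
        by (simp add: letter_act_def flip_flip fun_eq_iff prod_eq_iff)
    qed (use a finite_act_space[of Z X] in \<open>auto simp: rel_approx_def\<close>)
  qed auto
next
  case (amalg h n m)
  show ?case
  proof (intro exI[of _ "{h}"] exI[of _ 1] conjI allI impI)
    fix Z :: "'z set" and \<phi> c L e and X :: "(nat \<times> nat) set"
    assume a: "rel_approx G H {h} e Z \<phi> c" "finite X"
    have "mostly (act_space Z X L) e (\<lambda>z. good_point G H {h} \<phi> c (fst z))"
      using mostly_good_fst[OF a, of "[]"] by simp
    \<comment> \<open>An element of \<open>H\<close> preserves the colour of a good point, so its
      two flips coincide and cancel in either copy.\<close>
    then show "mostly (act_space Z X L) (1 * e)
        (\<lambda>z. word_act \<phi> c X L [(n, h)] z = word_act \<phi> c X L [(m, h)] z)"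
      by (rule mostly_mono)
         (use a amalg finite_act_space[of Z X] in \<open>auto simp: good_point_def letter_act_def flip_flip fun_eq_iff rel_approx_def\<close>)
  qed (use amalg in auto)
next
  case (ctx u v xs ys)
  obtain F k where 1: "finite F" "F \<subseteq> carrier G" "k \<ge> 0"
    "\<And>(Z :: 'z set) \<phi> c X L e. rel_approx G H F e Z \<phi> c \<Longrightarrow> finite X \<Longrightarrow>
       mostly (act_space Z X L) (k * e) (\<lambda>z. word_act \<phi> c X L u z = word_act \<phi> c X L v z)"
    using ctx.IH by blast
  show ?case
  proof (intro exI[of _ F] exI[of _ k] conjI allI impI)
    fix Z :: "'z set" and \<phi> c L e and X :: "(nat \<times> nat) set"
    assume a: "rel_approx G H F e Z \<phi> c" "finite X"
    have "bij_betw (word_act \<phi> c X L ys) (act_space Z X L) (act_space Z X L)"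
      by (rule word_act_bij[where G = G]) (use a ctx in \<open>auto simp: rel_approx_def\<close>)
    from mostly_bij[OF 1(4)[OF a] this]
    show "mostly (act_space Z X L) (k * e)
        (\<lambda>z. word_act \<phi> c X L (xs @ u @ ys) z = word_act \<phi> c X L (xs @ v @ ys) z)"
      by (rule mostly_mono) (use a finite_act_space[of Z X] in \<open>auto simp: rel_approx_def\<close>)
  qed (use 1 in auto)
qed

section \<open>Reduced words in the amalgamated product\<close>

definition reduced :: "('g, 'a) monoid_scheme \<Rightarrow> 'g set \<Rightarrow> (nat \<times> 'g) list \<Rightarrow> bool" where
  "reduced G H w \<longleftrightarrow> distinct_adj (map fst w) \<and> snd ` set w \<subseteq> carrier G - H"

lemma reduced_Cons:
  "reduced G H (l # w) \<longleftrightarrow>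
    snd l \<in> carrier G - H \<and> (w = [] \<or> fst l \<noteq> fst (hd w)) \<and> reduced G H w"
  by (cases w) (auto simp: reduced_def)

lemma amalg_rel_append:
  assumes "group G" "(u, u') \<in> amalg_rel G H" "(v, v') \<in> amalg_rel G H"
  shows "(u @ v, u' @ v') \<in> amalg_rel G H"
proof -
  have "(u @ v, u' @ v) \<in> amalg_rel G H"
    using amalg_rel.ctx[OF assms(2), of "[]" v] amalg_rel_lists[OF assms(1,3)] by simp
  moreover have "(u' @ v, u' @ v') \<in> amalg_rel G H"
    using amalg_rel.ctx[OF assms(3), of u' "[]"] amalg_rel_lists[OF assms(1,2)] by simp
  ultimately show ?thesis by (rule amalg_rel.trans)
qed

text \<open>If the copies differ, the letter \<open>g\<close> lies in \<open>H\<close> and can first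
  be moved into the copy of its neighbour; then the multiplication table applies.\<close>

lemma amalg_rel_mult_Cons:
  assumes "group G" "subgroup H G" "w \<in> lists (UNIV \<times> carrier G)"
    "g \<in> carrier G" "h \<in> carrier G" "n = m \<or> g \<in> H"
  shows "((n, g) # (m, h) # w, (m, g \<otimes>\<^bsub>G\<^esub> h) # w) \<in> amalg_rel G H"
proof -
  have "([(n, g)], [(m, g)]) \<in> amalg_rel G H"
    using assms(4,6) by (auto intro: amalg_rel.refl amalg_rel.amalg)
  from amalg_rel_append[OF assms(1) this amalg_rel.refl[of "[(m, h)]"]]
  have "([(n, g), (m, h)], [(m, g), (m, h)]) \<in> amalg_rel G H"
    using assms(5) by simp
  from amalg_rel.trans[OF this amalg_rel.mult[OF assms(4,5)]]
  have "([(n, g), (m, h)], [(m, g \<otimes>\<^bsub>G\<^esub> h)]) \<in> amalg_rel G H" .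
  from amalg_rel_append[OF assms(1) this amalg_rel.refl[OF assms(3)]]
  show ?thesis by simp
qed

lemma reduced_lists: "reduced G H w \<Longrightarrow> w \<in> lists (UNIV \<times> carrier G)"
  by (auto simp: reduced_def image_subset_iff)

text \<open>Induction on the word: a letter is put in front of a reduced word and merged with it
  where necessary. No coset representatives are chosen, since only existence of a reduced word is
  used, not uniqueness. Elements of \<open>H\<close> form a separate alternative and are placed in
  copy 0.\<close>

lemma ex_reduced:
  assumes "group G" "subgroup H G" "w \<in> lists (UNIV \<times> carrier G)"
  shows "\<exists>w'. (w, w') \<in> amalg_rel G H \<and> ((\<exists>h\<in>H. w' = [(0, h)]) \<or> (w' \<noteq> [] \<and> reduced G H w'))"
  using assms(3)
proof (induction w)
  case Nil
  have "([], [(0, \<one>\<^bsub>G\<^esub>)]) \<in> amalg_rel G H"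
    by (rule amalg_rel.sym[OF amalg_rel.one])
  then show ?case using subgroup.one_closed[OF assms(2)] by blast
next
  case (Cons l w)
  interpret group G by fact
  interpret H: subgroup H G by fact
  obtain n g where l: "l = (n, g)" and g: "g \<in> carrier G"
    using Cons.hyps by (cases l) auto
  obtain w' where w': "(w, w') \<in> amalg_rel G H"
    and cases: "(\<exists>h\<in>H. w' = [(0, h)]) \<or> (w' \<noteq> [] \<and> reduced G H w')"
    using Cons.IH by blast
  have "([l], [l]) \<in> amalg_rel G H" using Cons.hyps by (intro amalg_rel.refl) auto
  from amalg_rel_append[OF assms(1) this w'] have lw: "(l # w, l # w') \<in> amalg_rel G H" by simp
  have single: ?case if "(l # w, [(m, k)]) \<in> amalg_rel G H" "k \<in> carrier G" for m k
  proof (cases "k \<in> H")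
    case True
    then show ?thesis
      using amalg_rel.trans[OF that(1) amalg_rel.amalg[OF True that(2), of m 0]] by blast
  next
    case False
    then show ?thesis using that by (intro exI[of _ "[(m, k)]"]) (auto simp: reduced_def)
  qed
  have merge_in: "h \<otimes>\<^bsub>G\<^esub> k \<in> carrier G - H" if "h \<in> H" "k \<in> carrier G - H" for h k
    using that H.m_closed[of "inv\<^bsub>G\<^esub> h" "h \<otimes>\<^bsub>G\<^esub> k"] H.subset
    by (auto simp: m_assoc[symmetric] subset_iff)
  show ?case
    using cases
  proof
    assume "\<exists>h\<in>H. w' = [(0, h)]"
    then obtain h where h: "h \<in> H" "w' = [(0, h)]" by blast
    have "([(0, h)], [(n, h)]) \<in> amalg_rel G H" using h by (intro amalg_rel.amalg) auto
    from amalg_rel_append[OF assms(1) \<open>([l], [l]) \<in> amalg_rel G H\<close> this]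
    have "(l # w', [(n, g), (n, h)]) \<in> amalg_rel G H" using h l by simp
    from amalg_rel.trans[OF this amalg_rel.mult[OF g]]
    have "(l # w', [(n, g \<otimes>\<^bsub>G\<^esub> h)]) \<in> amalg_rel G H" using h by auto
    from single[OF amalg_rel.trans[OF lw this]] show ?case using g h by auto
  next
    assume "w' \<noteq> [] \<and> reduced G H w'"
    then obtain m k r where r: "w' = (m, k) # r" and red: "reduced G H ((m, k) # r)"
      by (cases w') auto
    then have k: "k \<in> carrier G - H" and redr: "reduced G H r" by (auto simp: reduced_Cons)
    have merge: "(l # w, (m, g \<otimes>\<^bsub>G\<^esub> k) # r) \<in> amalg_rel G H" if "n = m \<or> g \<in> H"
      using amalg_rel.trans[OF lw] amalg_rel_mult_Cons[OF assms(1,2) reduced_lists[OF redr] g _ that, of k]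
        l r k by simp
    \<comment> \<open>Either \<open>g\<close> is absorbed by the first letter, or it starts a new
      syllable, or it merges with a first letter of the same copy; the product then lies outside or
      inside \<open>H\<close>.\<close>
    consider "g \<in> H" | "g \<notin> H" "n \<noteq> m" | "n = m" "g \<otimes>\<^bsub>G\<^esub> k \<notin> H" | "n = m" "g \<otimes>\<^bsub>G\<^esub> k \<in> H" by blast
    then show ?case
    proof cases
      case 1
      have "reduced G H ((m, g \<otimes>\<^bsub>G\<^esub> k) # r)"
        using red merge_in[OF 1 k] by (simp add: reduced_Cons)
      then show ?thesis using merge 1 by blast
    next
      case 2
      have "reduced G H (l # w')"
        using red r l g 2 reduced_Cons[of G H l w'] by simp
      then show ?thesis using lw by blast
    next
      case 3
      have "reduced G H ((m, g \<otimes>\<^bsub>G\<^esub> k) # r)"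
        using red 3 g k by (simp add: reduced_Cons)
      then show ?thesis using merge 3 by blast
    next
      case 4
      show ?thesis
      proof (cases r)
        case Nil
        then show ?thesis using single[of m "g \<otimes>\<^bsub>G\<^esub> k"] merge 4 g k by auto
      next
        case (Cons p r')
        obtain m' k' where p: "p = (m', k')" by (cases p)
        have red': "reduced G H r'" and k': "k' \<in> carrier G - H"
          using redr Cons p by (auto simp: reduced_Cons)
        \<comment> \<open>The syllable has collapsed into \<open>H\<close>. The next letter absorbs
          it and stays outside \<open>H\<close>, so no further collapse can follow.\<close>
        have "((m, g \<otimes>\<^bsub>G\<^esub> k) # r, (m', (g \<otimes>\<^bsub>G\<^esub> k) \<otimes>\<^bsub>G\<^esub> k') # r') \<in> amalg_rel G H"
          using amalg_rel_mult_Cons[OF assms(1,2) reduced_lists[OF red'], of "g \<otimes>\<^bsub>G\<^esub> k" k' m m'] Cons p 4 g k k'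
          by auto
        moreover have "reduced G H ((m', (g \<otimes>\<^bsub>G\<^esub> k) \<otimes>\<^bsub>G\<^esub> k') # r')"
          using redr merge_in[OF 4(2) k'] Cons p by (simp add: reduced_Cons)
        ultimately show ?thesis using amalg_rel.trans[OF merge[OF disjI1[OF 4(1)]]] by blast
      qed
    qed
  qed
qed

text \<open>Along a trajectory of good points a reduced word of length \<open>k\<close> acts on the second
  coordinate by an alternating product of \<open>2 * k\<close> flips in which neighbouring letters differ,
  so it cannot fix any permutation.\<close>

lemma reduced_act:
  fixes c :: "'z \<Rightarrow> nat"
  assumes "rel_approx G H F e Z \<phi> c" "finite X" "reduced G H w" "snd ` set w \<subseteq> F"
    "(fst ` set w) \<times> c ` Z \<subseteq> X" "2 * length w \<le> L"
  shows "mostly (act_space Z X L) (real (length w) * e) (\<lambda>z. \<exists>p. snd (word_act \<phi> c X L w z) = p \<circ> snd z \<and>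
     p [] \<in> words X L \<and> length (p []) = 2 * length w \<and>
     (w \<noteq> [] \<longrightarrow> hd (p []) = (fst (hd w), c (fst (word_act \<phi> c X L w z)))))"
  using assms(3-6)
proof (induction w)
  case Nil
  have "mostly (act_space Z X L) 0 (\<lambda>_. True)" by (simp add: mostly_def)
  then show ?case
    by (rule mostly_mono)
       (use assms in \<open>auto intro!: finite_act_space exI[of _ id] simp: rel_approx_def\<close>)
next
  case (Cons l w)
  have fin: "finite (act_space Z X L)"
    using assms by (intro finite_act_space) (auto simp: rel_approx_def)
  obtain n g where l: "l = (n, g)" by (cases l)
  have red: "reduced G H w" and g: "g \<in> carrier G" "g \<notin> H" and n: "w = [] \<or> fst (hd w) \<noteq> n"
    using Cons.prems l by (auto simp: reduced_Cons)
  have wl: "w \<in> lists (UNIV \<times> carrier G)" by (rule reduced_lists[OF red])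
  have bij: "bij_betw (word_act \<phi> c X L w) (act_space Z X L) (act_space Z X L)"
    by (rule word_act_bij[where G = G]) (use assms wl in \<open>auto simp: rel_approx_def\<close>)
  have "mostly (act_space Z X L) (real (length w) * e + e) (\<lambda>z. (\<exists>p. snd (word_act \<phi> c X L w z) = p \<circ> snd z \<and>
     p [] \<in> words X L \<and> length (p []) = 2 * length w \<and>
     (w \<noteq> [] \<longrightarrow> hd (p []) = (fst (hd w), c (fst (word_act \<phi> c X L w z))))) \<and>
     good_point G H F \<phi> c (fst (word_act \<phi> c X L w z)))"
    by (intro mostly_conj Cons.IH mostly_good_fst assms wl fin red) (use Cons.prems in auto)
  then show ?case
  proof (rule mostly_mono)
    fix z assume z: "z \<in> act_space Z X L"
    define y where "y = word_act \<phi> c X L w z"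
    have y: "y \<in> act_space Z X L" unfolding y_def using bij z by (auto dest: bij_betwE)
    assume "(\<exists>p. snd (word_act \<phi> c X L w z) = p \<circ> snd z \<and>
      p [] \<in> words X L \<and> length (p []) = 2 * length w \<and>
      (w \<noteq> [] \<longrightarrow> hd (p []) = (fst (hd w), c (fst (word_act \<phi> c X L w z))))) \<and>
      good_point G H F \<phi> c (fst (word_act \<phi> c X L w z))"
    then obtain p where p: "snd y = p \<circ> snd z" "p [] \<in> words X L" "length (p []) = 2 * length w"
      "w \<noteq> [] \<Longrightarrow> hd (p []) = (fst (hd w), c (fst y))" and good: "good_point G H F \<phi> c (fst y)"
      by (auto simp: y_def)
    \<comment> \<open>As \<open>g\<close> lies outside \<open>H\<close>, the two letters contributed
      by this step have different colours.\<close>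
    have c: "c (\<phi> g (fst y)) \<noteq> c (fst y)"
      using good g Cons.prems l by (auto simp: good_point_def)
    have "\<phi> g (fst y) \<in> Z"
      using assms(1) g y bij_betwE[of "\<phi> g" Z Z] by (auto simp: rel_approx_def)
    then have X: "(n, c (fst y)) \<in> X" "(n, c (\<phi> g (fst y))) \<in> X"
      using Cons.prems(3) l y by auto
    \<comment> \<open>Here the tracked head is used: it belongs to the copy of the first letter of
      \<open>w\<close>, which differs from \<open>n\<close>.\<close>
    have hd: "p [] = [] \<or> hd (p []) \<noteq> (n, c (fst y))"
      using p n by (cases "w = []") auto
    \<comment> \<open>The radius is at least \<open>2 * length (l # w)\<close>, so both new letters
      fit into the ball and neither flip meets its boundary.\<close>
    have 1: "flip X L (n, c (fst y)) (p []) = (n, c (fst y)) # p []"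
      "(n, c (fst y)) # p [] \<in> words X L"
      by (rule flip_Cons; use p X hd Cons.prems in auto)+
    have 2: "flip X L (n, c (\<phi> g (fst y))) ((n, c (fst y)) # p []) = (n, c (\<phi> g (fst y))) # (n, c (fst y)) # p []"
      "(n, c (\<phi> g (fst y))) # (n, c (fst y)) # p [] \<in> words X L"
      by (rule flip_Cons; use 1 p X c Cons.prems in auto)+
    show "\<exists>p. snd (word_act \<phi> c X L (l # w) z) = p \<circ> snd z \<and>
      p [] \<in> words X L \<and> length (p []) = 2 * length (l # w) \<and>
      (l # w \<noteq> [] \<longrightarrow> hd (p []) = (fst (hd (l # w)), c (fst (word_act \<phi> c X L (l # w) z))))"
      by (rule exI[of _ "flip X L (n, c (\<phi> g (fst y))) \<circ> flip X L (n, c (fst y)) \<circ> p"])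
         (use 1 2 p in \<open>simp add: letter_act_def l y_def[symmetric] comp_assoc\<close>)
  qed (use fin in \<open>auto simp: algebra_simps\<close>)
qed

text \<open>The word is replaced by a reduced one or by a letter of \<open>H\<close>. A nontrivial
  letter of \<open>H\<close> moves the first coordinate; a nonempty reduced word moves the second.
  \<open>I\<close> collects the copies that occur and \<open>m\<close> is the radius required. The
  generators \<open>X\<close> are quantified after the colouring, since they must include its
  colours.\<close>

lemma nontrivial_act_moves:
  fixes G :: "('g, 'a) monoid_scheme" and H :: "'g set"
  assumes "group G" "subgroup H G" "w \<in> lists (UNIV \<times> carrier G)" "(w, []) \<notin> amalg_rel G H"
  shows "\<exists>F k I m. finite F \<and> F \<subseteq> carrier G \<and> k \<ge> 0 \<and> finite I \<and>
    (\<forall>(Z :: 'z set) \<phi> c X L e. rel_approx G H F e Z \<phi> c \<longrightarrow> finite X \<longrightarrow> I \<times> c ` Z \<subseteq> X \<longrightarrow> m \<le> L \<longrightarrow>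
       mostly (act_space Z X L) (k * e) (\<lambda>z. word_act \<phi> c X L w z \<noteq> z))"
proof -
  interpret group G by fact
  obtain w' where ww': "(w, w') \<in> amalg_rel G H"
    and cases: "(\<exists>h\<in>H. w' = [(0, h)]) \<or> (w' \<noteq> [] \<and> reduced G H w')"
    using ex_reduced[OF assms(1-3)] by blast
  have w': "w' \<in> lists (UNIV \<times> carrier G)" using amalg_rel_lists[OF assms(1) ww'] by simp
  obtain F k where 1: "finite F" "F \<subseteq> carrier G" "k \<ge> 0"
    "\<And>(Z :: 'z set) \<phi> c X L e. rel_approx G H F e Z \<phi> c \<Longrightarrow> finite X \<Longrightarrow>
       mostly (act_space Z X L) (k * e) (\<lambda>z. word_act \<phi> c X L w z = word_act \<phi> c X L w' z)"
    using amalg_rel_act[OF assms(1) ww', where 'z = 'z] by blast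
  let ?F = "F \<union> snd ` set w'"
  have "mostly (act_space Z X L) ((k + real (length w')) * e) (\<lambda>z. word_act \<phi> c X L w z \<noteq> z)"
    if a: "rel_approx G H ?F e Z \<phi> c" "finite X" "fst ` set w' \<times> c ` Z \<subseteq> X" "2 * length w' \<le> L"
    for Z :: "'z set" and \<phi> c X L e
  proof -
    have fin: "finite (act_space Z X L)"
      using a by (intro finite_act_space) (auto simp: rel_approx_def)
    have "mostly (act_space Z X L) (real (length w') * e) (\<lambda>z. word_act \<phi> c X L w' z \<noteq> z)"
      using cases
    proof
      assume "\<exists>h\<in>H. w' = [(0, h)]"
      then obtain h where h: "h \<in> H" "w' = [(0, h)]" by blast
      \<comment> \<open>Otherwise \<open>w\<close> would be equivalent to the empty word.\<close>
      have h1: "h \<noteq> \<one>\<^bsub>G\<^esub>"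
        using amalg_rel.trans[OF ww'] amalg_rel.one[of 0 G H] assms(4) h by auto
      have "mostly (act_space Z X L) e (\<lambda>z. good_point G H ?F \<phi> c (fst z))"
        using mostly_good_fst[OF a(1,2), of "[]"] by simp
      then show ?thesis
        by (rule mostly_mono) (use fin h h1 in \<open>auto simp: good_point_def letter_act_def prod_eq_iff\<close>)
    next
      assume *: "w' \<noteq> [] \<and> reduced G H w'"
      have "mostly (act_space Z X L) (real (length w') * e) (\<lambda>z. \<exists>p. snd (word_act \<phi> c X L w' z) = p \<circ> snd z \<and>
         p [] \<in> words X L \<and> length (p []) = 2 * length w' \<and>
         (w' \<noteq> [] \<longrightarrow> hd (p []) = (fst (hd w'), c (fst (word_act \<phi> c X L w' z)))))"
        by (rule reduced_act[OF a(1,2)]) (use * a in auto)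
      then show ?thesis
      proof (rule mostly_mono)
        fix z assume z: "z \<in> act_space Z X L"
        assume "\<exists>p. snd (word_act \<phi> c X L w' z) = p \<circ> snd z \<and>
         p [] \<in> words X L \<and> length (p []) = 2 * length w' \<and>
         (w' \<noteq> [] \<longrightarrow> hd (p []) = (fst (hd w'), c (fst (word_act \<phi> c X L w' z))))"
        then obtain p where p: "snd (word_act \<phi> c X L w' z) = p \<circ> snd z" "length (p []) = 2 * length w'"
          by blast
        \<comment> \<open>The two permutations are compared at the point that the old one sends to
          the empty word: the new one sends it to \<open>p []\<close>, which has positive
          length.\<close>
        have "surj (snd z)" using z by (auto dest: permutes_surj)
        then obtain v where v: "snd z v = []" by (metis surjD)
        have "snd (word_act \<phi> c X L w' z) v \<noteq> snd z v"
          using p v * by auto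
        then show "word_act \<phi> c X L w' z \<noteq> z" by auto
      qed (use fin in auto)
    qed
    from mostly_conj[OF 1(4)[OF rel_approx_mono[OF a(1) Un_upper1] a(2)] this fin]
    show ?thesis
      by (rule mostly_mono) (use fin in \<open>auto simp: algebra_simps\<close>)
  qed
  then show ?thesis
    using 1 w' by (intro exI[of _ ?F] exI[of _ "k + real (length w')"] exI[of _ "fst ` set w'"]
        exI[of _ "2 * length w'"]) auto
qed

section \<open>The amalgamated product as a group, and its soficity\<close>

lemma equiv_amalg_rel:
  assumes "group G"
  shows "equiv (lists (UNIV \<times> carrier G)) (amalg_rel G H)"
proof (rule equivI)
  show "amalg_rel G H \<subseteq> lists (UNIV \<times> carrier G) \<times> lists (UNIV \<times> carrier G)"
    using amalg_rel_lists[OF assms] by fast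
qed (auto simp: refl_on_def intro: symI transI amalg_rel.intros)

lemma amalg_carrier_cases:
  assumes "A \<in> carrier (amalg_free_product G H)"
  obtains w where "w \<in> lists (UNIV \<times> carrier G)" "A = amalg_rel G H `` {w}"
  using assms unfolding amalg_free_product_def partial_object.simps by (elim quotientE)

lemma amalg_rep:
  assumes "group G" "A \<in> carrier (amalg_free_product G H)"
  shows "(SOME a. a \<in> A) \<in> lists (UNIV \<times> carrier G)" "amalg_rel G H `` {SOME a. a \<in> A} = A"
proof -
  obtain w where w: "w \<in> lists (UNIV \<times> carrier G)" "A = amalg_rel G H `` {w}"
    using assms(2) by (rule amalg_carrier_cases)
  have "w \<in> A" using w by (auto intro: amalg_rel.refl)
  then have "(SOME a. a \<in> A) \<in> A" by (rule someI)
  then have *: "(w, SOME a. a \<in> A) \<in> amalg_rel G H" using w(2) by auto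
  then show "(SOME a. a \<in> A) \<in> lists (UNIV \<times> carrier G)"
    using amalg_rel_lists[OF assms(1)] by blast
  show "amalg_rel G H `` {SOME a. a \<in> A} = A"
    using equiv_class_eq[OF equiv_amalg_rel[OF assms(1)] *] by (simp only: w(2)[symmetric])
qed

lemma amalg_rep_class:
  assumes "group G" "w \<in> lists (UNIV \<times> carrier G)"
  shows "(SOME a. a \<in> amalg_rel G H `` {w}, w) \<in> amalg_rel G H"
proof -
  have "w \<in> amalg_rel G H `` {w}" using assms(2) by (auto intro: amalg_rel.refl)
  then have "(SOME a. a \<in> amalg_rel G H `` {w}) \<in> amalg_rel G H `` {w}" by (rule someI)
  then show ?thesis by (auto intro: amalg_rel.sym)
qed

lemma amalg_mult_class:
  assumes "group G" "u \<in> lists (UNIV \<times> carrier G)" "v \<in> lists (UNIV \<times> carrier G)"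
  shows "amalg_rel G H `` {u} \<otimes>\<^bsub>amalg_free_product G H\<^esub> amalg_rel G H `` {v} = amalg_rel G H `` {u @ v}"
  using equiv_class_eq[OF equiv_amalg_rel[OF assms(1)]
      amalg_rel_append[OF assms(1) amalg_rep_class[OF assms(1,2)] amalg_rep_class[OF assms(1,3)]]]
  by (simp add: amalg_free_product_def)

lemma amalg_class_in_carrier:
  "w \<in> lists (UNIV \<times> carrier G) \<Longrightarrow> amalg_rel G H `` {w} \<in> carrier (amalg_free_product G H)"
  by (simp add: amalg_free_product_def quotientI)

lemma amalg_one: "\<one>\<^bsub>amalg_free_product G H\<^esub> = amalg_rel G H `` {[]}"
  by (simp add: amalg_free_product_def)

lemma amalg_word_inverse:
  assumes "group G" "w \<in> lists (UNIV \<times> carrier G)"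
  shows "\<exists>v\<in>lists (UNIV \<times> carrier G). (v @ w, []) \<in> amalg_rel G H"
  using assms(2)
proof (induction w)
  case Nil
  show ?case by (auto intro!: bexI[of _ "[]"] amalg_rel.refl)
next
  case (Cons l w)
  interpret group G by fact
  obtain n g where l: "l = (n, g)" "g \<in> carrier G" using Cons.hyps by (cases l) auto
  obtain v where v: "v \<in> lists (UNIV \<times> carrier G)" "(v @ w, []) \<in> amalg_rel G H"
    using Cons.IH by blast
  have "([(n, inv\<^bsub>G\<^esub> g), (n, g)], [(n, \<one>\<^bsub>G\<^esub>)]) \<in> amalg_rel G H"
    using amalg_rel.mult[of "inv\<^bsub>G\<^esub> g" G g n H] l by simp
  from amalg_rel.trans[OF this amalg_rel.one]
  have "(v @ [(n, inv\<^bsub>G\<^esub> g), (n, g)] @ w, v @ [] @ w) \<in> amalg_rel G H"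
    using v Cons.hyps by (intro amalg_rel.ctx) auto
  then have "((v @ [(n, inv\<^bsub>G\<^esub> g)]) @ l # w, []) \<in> amalg_rel G H"
    using amalg_rel.trans v l by fastforce
  then show ?case using v l by (intro bexI[of _ "v @ [(n, inv\<^bsub>G\<^esub> g)]"]) auto
qed

lemma group_amalg_free_product:
  assumes "group G"
  shows "group (amalg_free_product G H)"
proof (rule groupI)
  let ?A = "amalg_free_product G H"
  have app: "u @ v \<in> lists (UNIV \<times> carrier G)"
    if "u \<in> lists (UNIV \<times> carrier G)" "v \<in> lists (UNIV \<times> carrier G)" for u v
    using that by simp
  show "x \<otimes>\<^bsub>?A\<^esub> y \<in> carrier ?A" if "x \<in> carrier ?A" "y \<in> carrier ?A" for x y
    using that by (elim amalg_carrier_cases)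
      (simp only: amalg_mult_class[OF assms] amalg_class_in_carrier app)
  show "\<one>\<^bsub>?A\<^esub> \<in> carrier ?A" by (simp add: amalg_one amalg_class_in_carrier)
  show "x \<otimes>\<^bsub>?A\<^esub> y \<otimes>\<^bsub>?A\<^esub> z = x \<otimes>\<^bsub>?A\<^esub> (y \<otimes>\<^bsub>?A\<^esub> z)"
    if "x \<in> carrier ?A" "y \<in> carrier ?A" "z \<in> carrier ?A" for x y z
    using that by (elim amalg_carrier_cases)
      (simp only: amalg_mult_class[OF assms] app append_assoc)
  show "\<one>\<^bsub>?A\<^esub> \<otimes>\<^bsub>?A\<^esub> x = x" if "x \<in> carrier ?A" for x
    using that by (elim amalg_carrier_cases)
      (simp only: amalg_mult_class[OF assms] amalg_one lists.Nil append_Nil)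
  show "\<exists>y\<in>carrier ?A. y \<otimes>\<^bsub>?A\<^esub> x = \<one>\<^bsub>?A\<^esub>" if x: "x \<in> carrier ?A" for x
  proof -
    obtain w where w: "w \<in> lists (UNIV \<times> carrier G)" "x = amalg_rel G H `` {w}"
      using x by (rule amalg_carrier_cases)
    obtain v where v: "v \<in> lists (UNIV \<times> carrier G)" "(v @ w, []) \<in> amalg_rel G H"
      using amalg_word_inverse[OF assms w(1)] by blast
    have "amalg_rel G H `` {v} \<otimes>\<^bsub>?A\<^esub> x = \<one>\<^bsub>?A\<^esub>"
      using equiv_class_eq[OF equiv_amalg_rel[OF assms] v(2)]
      by (simp only: w amalg_mult_class[OF assms v(1) w(1)] amalg_one)
    then show ?thesis using amalg_class_in_carrier[OF v(1)] by blast
  qed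
qed

text \<open>A class acts through a chosen word. This is multiplicative only up to the error of a
  derivation from \<open>rep g @ rep h\<close> to the word chosen for the product. The order of
  choices matters: the words of \<open>F\<close> determine \<open>E\<close>, \<open>k\<close> and
  \<open>L\<close>; these determine the accuracy of the relative approximation; its colouring then
  determines \<open>X\<close>.\<close>

lemma sofic_amalg_free_product:
  fixes G :: "('g, 'a) monoid_scheme" and H :: "'g set"
  assumes "group G" "subgroup H G"
    and approx: "\<And>F e. finite F \<Longrightarrow> F \<subseteq> carrier G \<Longrightarrow> e > 0 \<Longrightarrow>
      \<exists>(Z :: 'z set) \<phi> c. rel_approx G H F e Z \<phi> c"
  shows "sofic (amalg_free_product G H)"
proof (rule soficI[where 'z = "'z \<times> ((nat \<times> nat) list \<Rightarrow> (nat \<times> nat) list)"])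
  let ?A = "amalg_free_product G H"
  show "group ?A" by (rule group_amalg_free_product) fact
  fix F and e :: real
  assume F: "finite F" "F \<subseteq> carrier ?A" and e: "e > 0"
  define rep :: "(nat \<times> 'g) list set \<Rightarrow> (nat \<times> 'g) list" where "rep A = (SOME a. a \<in> A)" for A
  have rep: "rep A \<in> lists (UNIV \<times> carrier G)" "amalg_rel G H `` {rep A} = A" if "A \<in> carrier ?A" for A
    using amalg_rep[OF assms(1) that] by (simp_all only: rep_def)
  define mult_ok where "mult_ok p E k \<longleftrightarrow> finite E \<and> E \<subseteq> carrier G \<and> k \<ge> 0 \<and>
    (\<forall>(Z :: 'z set) \<phi> c X L e. rel_approx G H E e Z \<phi> c \<longrightarrow> finite X \<longrightarrow>
       mostly (act_space Z X L) (k * e)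
        (\<lambda>z. word_act \<phi> c X L (rep (fst p \<otimes>\<^bsub>?A\<^esub> snd p)) z = word_act \<phi> c X L (rep (fst p) @ rep (snd p)) z))"
    for p E k
  define free_ok where "free_ok A E k I m \<longleftrightarrow> finite E \<and> E \<subseteq> carrier G \<and> k \<ge> 0 \<and> finite I \<and>
    (\<forall>(Z :: 'z set) \<phi> c X L e. rel_approx G H E e Z \<phi> c \<longrightarrow> finite X \<longrightarrow> I \<times> c ` Z \<subseteq> X \<longrightarrow> m \<le> L \<longrightarrow>
       mostly (act_space Z X L) (k * e) (\<lambda>z. word_act \<phi> c X L (rep A) z \<noteq> z))"
    for A E k I m
  have "\<exists>E k. mult_ok p E k" if "p \<in> F \<times> F" for p
  proof -
    have p: "fst p \<in> carrier ?A" "snd p \<in> carrier ?A" using that F by auto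
    have "fst p \<otimes>\<^bsub>?A\<^esub> snd p = amalg_rel G H `` {rep (fst p) @ rep (snd p)}"
      by (simp add: amalg_free_product_def rep_def)
    then have "(rep (fst p \<otimes>\<^bsub>?A\<^esub> snd p), rep (fst p) @ rep (snd p)) \<in> amalg_rel G H"
      using amalg_rep_class[OF assms(1), of "rep (fst p) @ rep (snd p)" H] rep(1)[OF p(1)] rep(1)[OF p(2)]
      by (simp add: rep_def)
    from amalg_rel_act[OF assms(1) this, where 'z = 'z] show ?thesis
      unfolding mult_ok_def .
  qed
  then obtain E1 k1 where 1: "\<And>p. p \<in> F \<times> F \<Longrightarrow> mult_ok p (E1 p) (k1 p)" by metis
  let ?F' = "F - {\<one>\<^bsub>?A\<^esub>}"
  have "\<exists>E k I m. free_ok A E k I m" if "A \<in> ?F'" for A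
  proof -
    have A: "A \<in> carrier ?A" using that F by auto
    have "(rep A, []) \<notin> amalg_rel G H"
    proof
      assume "(rep A, []) \<in> amalg_rel G H"
      from equiv_class_eq[OF equiv_amalg_rel[OF assms(1)] this] have "A = \<one>\<^bsub>?A\<^esub>"
        using rep(2)[OF A] by (simp only: amalg_one)
      then show False using that by simp
    qed
    from nontrivial_act_moves[OF assms(1,2) rep(1)[OF A] this, where 'z = 'z] show ?thesis
      unfolding free_ok_def .
  qed
  then obtain E2 k2 I m where 2: "\<And>A. A \<in> ?F' \<Longrightarrow> free_ok A (E2 A) (k2 A) (I A) (m A)" by metis
  have E1_ok: "finite (E1 p)" "E1 p \<subseteq> carrier G" "k1 p \<ge> 0" if "p \<in> F \<times> F" for p
    using 1[OF that] by (simp_all add: mult_ok_def)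
  have E2_ok: "finite (E2 A)" "E2 A \<subseteq> carrier G" "k2 A \<ge> 0" "finite (I A)" if "A \<in> ?F'" for A
    using 2[OF that] by (simp_all add: free_ok_def)
  define E where "E = (\<Union>p\<in>F \<times> F. E1 p) \<union> (\<Union>A\<in>?F'. E2 A)"
  \<comment> \<open>The sums serve as common upper bounds for the individual constants; the summand
    1 makes \<open>k\<close> positive, so that \<open>e / k\<close> can be taken as
    accuracy.\<close>
  define k where "k = 1 + (\<Sum>p\<in>F \<times> F. k1 p) + (\<Sum>A\<in>?F'. k2 A)"
  define L where "L = (\<Sum>A\<in>?F'. m A)"
  have E: "finite E" "E \<subseteq> carrier G"
    unfolding E_def using F E1_ok(1,2) E2_ok(1,2) by (blast intro: finite_UN_I)+
  have s1: "(\<Sum>p\<in>F \<times> F. k1 p) \<ge> 0" by (intro sum_nonneg E1_ok)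
  have s2: "(\<Sum>A\<in>?F'. k2 A) \<ge> 0" by (intro sum_nonneg E2_ok)
  have k: "k > 0" using s1 s2 by (simp add: k_def)
  have k1: "k1 p \<le> k" if "p \<in> F \<times> F" for p
  proof -
    have "k1 p \<le> (\<Sum>p\<in>F \<times> F. k1 p)"
      using that F by (intro member_le_sum E1_ok) auto
    then show ?thesis using s2 by (simp add: k_def)
  qed
  have k2: "k2 A \<le> k" if "A \<in> ?F'" for A
  proof -
    have "k2 A \<le> (\<Sum>A\<in>?F'. k2 A)"
      using that F by (intro member_le_sum E2_ok) auto
    then show ?thesis using s1 by (simp add: k_def)
  qed
  have L: "m A \<le> L" if "A \<in> ?F'" for A
    unfolding L_def using that F by (intro member_le_sum) auto
  define d where "d = e / k"
  have d: "d > 0" and kd: "k * d = e" using e k by (simp_all add: d_def)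
  obtain Z :: "'z set" and \<phi> c where a: "rel_approx G H E d Z \<phi> c"
    using approx[OF E d] by blast
  define X where "X = (\<Union>A\<in>?F'. I A) \<times> c ` Z"
  have X: "finite X"
    unfolding X_def using F(1) E2_ok(4) a by (intro finite_cartesian_product finite_UN_I) (auto simp: rel_approx_def)
  have fin: "finite (act_space Z X L)"
    using a X by (intro finite_act_space) (auto simp: rel_approx_def)
  show "\<exists>(Z :: ('z \<times> ((nat \<times> nat) list \<Rightarrow> (nat \<times> nat) list)) set) \<rho>.
      finite Z \<and> Z \<noteq> {} \<and> (\<forall>g\<in>carrier ?A. bij_betw (\<rho> g) Z Z) \<and>
      (\<forall>g\<in>F. \<forall>h\<in>F. mostly Z e (\<lambda>z. \<rho> (g \<otimes>\<^bsub>?A\<^esub> h) z = \<rho> g (\<rho> h z))) \<and>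
      (\<forall>g\<in>F. g \<noteq> \<one>\<^bsub>?A\<^esub> \<longrightarrow> mostly Z e (\<lambda>z. \<rho> g z \<noteq> z))"
  proof (intro exI[of _ "act_space Z X L"] exI[of _ "\<lambda>A. word_act \<phi> c X L (rep A)"] conjI ballI impI)
    show "finite (act_space Z X L)" by (rule fin)
    show "act_space Z X L \<noteq> {}"
    proof -
      have "id \<in> {q. q permutes words X L}" by (simp add: permutes_id)
      then show ?thesis using a unfolding rel_approx_def by blast
    qed
    show "bij_betw (word_act \<phi> c X L (rep g)) (act_space Z X L) (act_space Z X L)" if "g \<in> carrier ?A" for g
      by (rule word_act_bij[where G = G]) (use a X rep(1)[OF that] in \<open>auto simp: rel_approx_def\<close>)
    show "mostly (act_space Z X L) e
        (\<lambda>z. word_act \<phi> c X L (rep (g \<otimes>\<^bsub>?A\<^esub> h)) z = word_act \<phi> c X L (rep g) (word_act \<phi> c X L (rep h) z))"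
      if gh: "g \<in> F" "h \<in> F" for g h
    proof -
      have p: "(g, h) \<in> F \<times> F" using gh by simp
      have "rel_approx G H (E1 (g, h)) d Z \<phi> c"
        by (rule rel_approx_mono[OF a]) (use p in \<open>auto simp: E_def\<close>)
      then have "mostly (act_space Z X L) (k1 (g, h) * d)
        (\<lambda>z. word_act \<phi> c X L (rep (g \<otimes>\<^bsub>?A\<^esub> h)) z = word_act \<phi> c X L (rep g @ rep h) z)"
        using 1[OF p] X by (auto simp: mult_ok_def)
      then show ?thesis
        by (rule mostly_mono) (use fin d k1[OF p] kd in \<open>auto intro: mult_right_mono[of _ k d, simplified kd]\<close>)
    qed
    show "mostly (act_space Z X L) e (\<lambda>z. word_act \<phi> c X L (rep g) z \<noteq> z)"
      if g: "g \<in> F" "g \<noteq> \<one>\<^bsub>?A\<^esub>" for g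
    proof -
      have p: "g \<in> ?F'" using g by simp
      have "rel_approx G H (E2 g) d Z \<phi> c"
        by (rule rel_approx_mono[OF a]) (use p in \<open>auto simp: E_def\<close>)
      moreover have "I g \<times> c ` Z \<subseteq> X" using p by (auto simp: X_def)
      ultimately have "mostly (act_space Z X L) (k2 g * d) (\<lambda>z. word_act \<phi> c X L (rep g) z \<noteq> z)"
        using 2[OF p] X L[OF p] unfolding free_ok_def by blast
      then show ?thesis
        by (rule mostly_mono) (use fin d k2[OF p] kd in \<open>auto intro: mult_right_mono[of _ k d, simplified kd]\<close>)
    qed
  qed
qed

subsection \<open>Approximations relative to an amenable subgroup\<close>

lemma mostly_Times_fiberwise:
  assumes "finite Z" "finite Y" "\<And>y. y \<in> Y \<Longrightarrow> mostly Z e (\<lambda>z. P (z, y))"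
  shows "mostly (Z \<times> Y) e P"
proof -
  have "{p \<in> Z \<times> Y. \<not> P p} = prod.swap ` (SIGMA y:Y. {z \<in> Z. \<not> P (z, y)})" by force
  then have "card {p \<in> Z \<times> Y. \<not> P p} = (\<Sum>y\<in>Y. card {z \<in> Z. \<not> P (z, y)})"
    using assms by (simp add: card_image)
  then have "real (card {p \<in> Z \<times> Y. \<not> P p}) = (\<Sum>y\<in>Y. real (card {z \<in> Z. \<not> P (z, y)}))"
    by simp
  also have "\<dots> \<le> (\<Sum>y\<in>Y. e * real (card Z))"
    using assms(3) by (intro sum_mono) (auto simp: mostly_def)
  finally show ?thesis
    by (simp add: mostly_def card_cartesian_product mult_ac)
qed

text \<open>Averaging: if every fibre exceeded the proportion \<open>e\<close>, so would the total.
  With \<open>Z\<close> a set of orderings, this replaces a random ordering by a fixed one.\<close>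

lemma mostly_Times_ex_fiber:
  assumes "finite Z" "finite Y" "Z \<noteq> {}" "mostly (Z \<times> Y) e P"
  shows "\<exists>z\<in>Z. mostly Y e (\<lambda>y. P (z, y))"
proof (rule ccontr)
  assume "\<not> ?thesis"
  then have *: "\<And>z. z \<in> Z \<Longrightarrow> e * real (card Y) < real (card {y \<in> Y. \<not> P (z, y)})"
    by (auto simp: mostly_def not_le)
  have "{p \<in> Z \<times> Y. \<not> P p} = (SIGMA z:Z. {y \<in> Y. \<not> P (z, y)})" by auto
  then have "card {p \<in> Z \<times> Y. \<not> P p} = (\<Sum>z\<in>Z. card {y \<in> Y. \<not> P (z, y)})"
    using assms by simp
  then have "real (card {p \<in> Z \<times> Y. \<not> P p}) = (\<Sum>z\<in>Z. real (card {y \<in> Y. \<not> P (z, y)}))"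
    by simp
  moreover have "(\<Sum>z\<in>Z. e * real (card Y)) < (\<Sum>z\<in>Z. real (card {y \<in> Y. \<not> P (z, y)}))"
    using assms * by (intro sum_strict_mono) auto
  ultimately show False
    using assms(4) by (simp add: mostly_def card_cartesian_product mult_ac)
qed

text \<open>Under a uniformly random ordering each point of \<open>W\<close> is equally likely to be
  the smallest. Precomposition with the transposition of two points of \<open>W\<close> exchanges
  the corresponding events, and these events partition all permutations.\<close>

lemma card_permutes_Min_at:
  fixes Y :: "nat set"
  assumes "finite Y" "W \<subseteq> Y" "w \<in> W"
  shows "card {\<tau>. \<tau> permutes Y \<and> Min (\<tau> ` W) = \<tau> w} * card W = card {\<tau>. \<tau> permutes Y}"
proof -
  define A where "A v = {\<tau>. \<tau> permutes Y \<and> Min (\<tau> ` W) = \<tau> v}" for v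
  have W: "finite W" "W \<noteq> {}" using assms by (auto intro: finite_subset)
  have finP: "finite {\<tau>. \<tau> permutes Y}" using assms(1) by (rule finite_permutations)
  have finA: "finite (A v)" for v by (rule finite_subset[OF _ finP]) (auto simp: A_def)
  have le: "card (A v) \<le> card (A u)" if "v \<in> W" "u \<in> W" for u v
  proof (rule card_inj_on_le)
    let ?t = "Transposition.transpose v u"
    have t: "?t permutes W" using that by (intro permutes_swap_id)
    have tY: "?t permutes Y" using that assms by (intro permutes_swap_id) auto
    show "inj_on (\<lambda>\<tau>. \<tau> \<circ> ?t) (A v)"
    proof (rule inj_onI)
      fix x y assume "x \<circ> ?t = y \<circ> ?t"
      then have "(x \<circ> ?t) \<circ> ?t = (y \<circ> ?t) \<circ> ?t" by simp
      then show "x = y" by (simp add: comp_assoc)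
    qed
    show "(\<lambda>\<tau>. \<tau> \<circ> ?t) ` A v \<subseteq> A u"
    proof
      fix x assume "x \<in> (\<lambda>\<tau>. \<tau> \<circ> ?t) ` A v"
      then obtain \<tau> where \<tau>: "\<tau> \<in> A v" "x = \<tau> \<circ> ?t" by blast
      have "x ` W = \<tau> ` W" using \<tau>(2) permutes_image[OF t] by (simp only: image_comp[symmetric])
      then show "x \<in> A u" using \<tau> permutes_compose[OF tY, of \<tau>] by (auto simp: A_def)
    qed
  qed (rule finA)
  have eq: "card (A v) = card (A w)" if "v \<in> W" for v
    using le that assms(3) by (intro antisym) auto
  have "{\<tau>. \<tau> permutes Y} = (\<Union>v\<in>W. A v)"
  proof
    show "{\<tau>. \<tau> permutes Y} \<subseteq> (\<Union>v\<in>W. A v)"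
    proof
      fix \<tau> assume "\<tau> \<in> {\<tau>. \<tau> permutes Y}"
      moreover have "Min (\<tau> ` W) \<in> \<tau> ` W" using W by (intro Min_in) auto
      ultimately show "\<tau> \<in> (\<Union>v\<in>W. A v)" by (auto simp: A_def)
    qed
  qed (auto simp: A_def)
  moreover have "card (\<Union>v\<in>W. A v) = (\<Sum>v\<in>W. card (A v))"
  proof (rule card_UN_disjoint)
    show "\<forall>v\<in>W. \<forall>u\<in>W. v \<noteq> u \<longrightarrow> A v \<inter> A u = {}"
    proof (intro ballI impI equals0I)
      fix v u \<tau> assume "v \<noteq> u" and \<tau>: "\<tau> \<in> A v \<inter> A u"
      then have "\<tau> v = \<tau> u" by (auto simp: A_def)
      moreover have "inj \<tau>" using \<tau> by (auto simp: A_def permutes_inj)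
      ultimately show False using \<open>v \<noteq> u\<close> by (auto dest: injD)
    qed
  qed (use W finA in auto)
  ultimately show ?thesis
    using eq by (simp add: A_def)
qed

text \<open>If the smallest point of the union lies in both sets, the two minima agree. So they can
  differ only when that point lies in the symmetric difference, and each point of the union is the
  smallest equally often.\<close>

lemma card_permutes_Min_neq:
  fixes Y :: "nat set"
  assumes "finite Y" "U \<subseteq> Y" "V \<subseteq> Y" "U \<noteq> {}" "V \<noteq> {}"
  shows "card {\<tau>. \<tau> permutes Y \<and> Min (\<tau> ` U) \<noteq> Min (\<tau> ` V)} * card (U \<union> V)
    \<le> card ((U - V) \<union> (V - U)) * card {\<tau>. \<tau> permutes Y}"
proof -
  define A where "A v = {\<tau>. \<tau> permutes Y \<and> Min (\<tau> ` (U \<union> V)) = \<tau> v}" for v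
  let ?D = "(U - V) \<union> (V - U)"
  have fin: "finite U" "finite V" using assms by (auto intro: finite_subset)
  have finA: "finite (A v)" for v
    by (rule finite_subset[OF _ finite_permutations[OF assms(1)]]) (auto simp: A_def)
  have sub: "{\<tau>. \<tau> permutes Y \<and> Min (\<tau> ` U) \<noteq> Min (\<tau> ` V)} \<subseteq> (\<Union>v\<in>?D. A v)"
  proof
    fix \<tau> assume \<tau>: "\<tau> \<in> {\<tau>. \<tau> permutes Y \<and> Min (\<tau> ` U) \<noteq> Min (\<tau> ` V)}"
    have "Min (\<tau> ` (U \<union> V)) \<in> \<tau> ` (U \<union> V)" using fin assms by (intro Min_in) auto
    then obtain v where v: "v \<in> U \<union> V" "Min (\<tau> ` (U \<union> V)) = \<tau> v" by blast
    have le: "\<tau> v \<le> \<tau> x" if "x \<in> U \<union> V" for x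
      using v(2) Min_le[of "\<tau> ` (U \<union> V)" "\<tau> x"] that fin by auto
    have "v \<in> ?D"
    proof (rule ccontr)
      assume "v \<notin> ?D"
      with v have "v \<in> U" "v \<in> V" by auto
      then have "Min (\<tau> ` U) = \<tau> v" "Min (\<tau> ` V) = \<tau> v"
        using fin le by (auto intro!: Min_eqI)
      with \<tau> show False by simp
    qed
    then show "\<tau> \<in> (\<Union>v\<in>?D. A v)" using \<tau> v by (auto simp: A_def)
  qed
  have "card {\<tau>. \<tau> permutes Y \<and> Min (\<tau> ` U) \<noteq> Min (\<tau> ` V)} \<le> card (\<Union>v\<in>?D. A v)"
    using sub fin finA by (intro card_mono) auto
  also have "\<dots> \<le> (\<Sum>v\<in>?D. card (A v))" using fin by (intro card_UN_le) auto
  finally have "card {\<tau>. \<tau> permutes Y \<and> Min (\<tau> ` U) \<noteq> Min (\<tau> ` V)} * card (U \<union> V)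
      \<le> (\<Sum>v\<in>?D. card (A v)) * card (U \<union> V)" by simp
  also have "\<dots> = (\<Sum>v\<in>?D. card {\<tau>. \<tau> permutes Y})"
    unfolding sum_distrib_right
  proof (rule sum.cong[OF HOL.refl])
    fix v assume "v \<in> ?D"
    then show "card (A v) * card (U \<union> V) = card {\<tau>. \<tau> permutes Y}"
      unfolding A_def using assms by (intro card_permutes_Min_at) auto
  qed
  finally show ?thesis by simp
qed

text \<open>Half of the error pays for points where the sofic approximation fails on
  \<open>N\<close>, the other half for orderings whose minima change under
  \<open>F \<inter> H\<close>. Elements outside \<open>H\<close> change the colour of a good point
  for every ordering.\<close>

lemma amenable_rel_approx:
  fixes G :: "('g, 'a) monoid_scheme"
  assumes "sofic G" "subgroup H G" "amenable (G\<lparr>carrier := H\<rparr>)"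
    and F: "finite F" "F \<subseteq> carrier G" and "e > 0"
  shows "\<exists>(n :: nat) \<phi> c. rel_approx G H F e {..<n} \<phi> c"
proof -
  interpret group G using assms(1) by (simp add: sofic_def)
  interpret H: subgroup H G by fact
  define d where "d = e / (2 * (1 + real (card F)))"
  have d: "d > 0" using assms(6) by (simp add: d_def)
  have Fd: "real (card (F \<inter> H)) * d \<le> e / 2"
  proof -
    have "real (card (F \<inter> H)) * d \<le> (1 + real (card F)) * d"
      using d F(1) card_mono[of F "F \<inter> H"] by (intro mult_right_mono) auto
    also have "\<dots> = e / 2" by (simp add: d_def field_simps)
    finally show ?thesis .
  qed
  let ?inv = "\<lambda>x. inv\<^bsub>G\<^esub> x"
  have "?inv ` (F \<inter> H) \<subseteq> carrier (G\<lparr>carrier := H\<rparr>) \<and> finite (?inv ` (F \<inter> H))" using F by auto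
  then have "\<exists>A \<subseteq> H. finite A \<and> A \<noteq> {} \<and> (\<forall>g\<in>?inv ` (F \<inter> H).
      real (card (((g <#\<^bsub>G\<^esub> A) - A) \<union> (A - (g <#\<^bsub>G\<^esub> A)))) < d * real (card A))"
    using assms(3)[unfolded amenable_def, THEN conjunct2, THEN spec, THEN mp, THEN spec, THEN mp,
        OF _ d, of "?inv ` (F \<inter> H)"]
    by (simp add: l_coset_def)
  then obtain A where A: "A \<subseteq> H" "finite A" "A \<noteq> {}" and Foelner: "\<And>h. h \<in> F \<inter> H \<Longrightarrow>
      real (card (((?inv h <#\<^bsub>G\<^esub> A) - A) \<union> (A - (?inv h <#\<^bsub>G\<^esub> A)))) < d * real (card A)"
    by blast
  have AG: "A \<subseteq> carrier G" using A H.subset by blast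
  \<comment> \<open>A Foelner set is almost invariant on the left. The colouring compares
    \<open>B\<close> with its right translates \<open>R h\<close>, so the set is inverted.\<close>
  define B where "B = ?inv ` A"
  have B: "B \<subseteq> H" "finite B" "B \<noteq> {}" using A by (auto simp: B_def)
  have BG: "B \<subseteq> carrier G" using B H.subset by blast
  have inj_inv: "inj_on ?inv (carrier G)" by (rule inj_on_inverseI[of _ ?inv]) simp
  have cardB: "card B = card A"
    unfolding B_def by (intro card_image inj_on_subset[OF inj_inv] AG)
  define R where "R g = (\<lambda>b. b \<otimes>\<^bsub>G\<^esub> g) ` B" for g
  have RG: "R g \<subseteq> carrier G" if "g \<in> carrier G" for g
    using that BG by (auto simp: R_def)
  have cardR: "real (card ((B - R h) \<union> (R h - B))) < d * real (card B)" if h: "h \<in> F \<inter> H" for h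
  proof -
    have hG: "h \<in> carrier G" using h F by auto
    let ?C = "?inv h <#\<^bsub>G\<^esub> A"
    have CG: "?C \<subseteq> carrier G" using hG AG by (auto simp: l_coset_def)
    have "R h = (\<lambda>a. ?inv a \<otimes>\<^bsub>G\<^esub> h) ` A" by (simp add: R_def B_def image_image)
    also have "\<dots> = (\<lambda>a. ?inv (?inv h \<otimes>\<^bsub>G\<^esub> a)) ` A"
      using hG AG by (intro image_cong) (auto simp: inv_mult_group)
    also have "\<dots> = ?inv ` ?C" by (auto simp: l_coset_def)
    finally have R: "R h = ?inv ` ?C" .
    have "(B - R h) \<union> (R h - B) = ?inv ` ((A - ?C) \<union> (?C - A))"
      unfolding R B_def image_Un
      using inj_on_image_set_diff[OF inj_inv _ CG, of A] inj_on_image_set_diff[OF inj_inv _ AG, of ?C] AG CG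
      by blast
    moreover have "card (?inv ` ((A - ?C) \<union> (?C - A))) = card ((A - ?C) \<union> (?C - A))"
      using AG CG by (intro card_image inj_on_subset[OF inj_inv]) auto
    ultimately show ?thesis
      using Foelner[OF h] cardB by (simp add: Un_commute)
  qed
  define M where "M = F \<union> B \<union> (\<Union>g\<in>F. R g)"
  \<comment> \<open>The quotients are included so that freeness on \<open>N\<close> makes the orbit
    map \<open>k \<mapsto> \<phi> k s\<close> injective on \<open>M\<close> at good points. There
    \<open>B\<close> and its translates can be counted inside the orbit.\<close>
  define N where "N = M \<union> (\<lambda>(k, l). ?inv k \<otimes>\<^bsub>G\<^esub> l) ` (M \<times> M)"
  have M: "finite M" "M \<subseteq> carrier G"
    using F B BG RG by (auto simp: M_def R_def)
  have N: "finite N" "N \<subseteq> carrier G" using M by (auto simp: N_def)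
  obtain n :: nat and \<phi> where n: "n > 0" and perm: "\<And>g. g \<in> carrier G \<Longrightarrow> \<phi> g permutes {..<n}"
    and most: "mostly {..<n} (e/2) (\<lambda>s. (\<forall>g\<in>N. \<forall>h\<in>N. \<phi> (g \<otimes>\<^bsub>G\<^esub> h) s = \<phi> g (\<phi> h s)) \<and>
        (\<forall>g\<in>N. g \<noteq> \<one>\<^bsub>G\<^esub> \<longrightarrow> \<phi> g s \<noteq> s))"
    using soficE[OF assms(1) N half_gt_zero[OF assms(6)]] by blast
  define good where "good s \<longleftrightarrow> (\<forall>g\<in>N. \<forall>h\<in>N. \<phi> (g \<otimes>\<^bsub>G\<^esub> h) s = \<phi> g (\<phi> h s)) \<and>
        (\<forall>g\<in>N. g \<noteq> \<one>\<^bsub>G\<^esub> \<longrightarrow> \<phi> g s \<noteq> s)" for s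
  have inj: "inj_on (\<lambda>k. \<phi> k s) M" if "good s" for s
  proof (rule inj_onI, rule ccontr)
    fix k l assume kl: "k \<in> M" "l \<in> M" "\<phi> k s = \<phi> l s" "k \<noteq> l"
    let ?m = "?inv k \<otimes>\<^bsub>G\<^esub> l"
    have G: "k \<in> carrier G" "l \<in> carrier G" using kl M by auto
    have mN: "?m \<in> N" "k \<in> N" using kl by (auto simp: N_def)
    have l: "k \<otimes>\<^bsub>G\<^esub> ?m = l" using G by (simp add: m_assoc[symmetric])
    then have "?m \<noteq> \<one>\<^bsub>G\<^esub>" using kl(4) G by auto
    then have "\<phi> ?m s \<noteq> s" using that mN by (auto simp: good_def)
    moreover have "\<phi> (k \<otimes>\<^bsub>G\<^esub> ?m) s = \<phi> k (\<phi> ?m s)" using that mN unfolding good_def by blast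
    then have "\<phi> k (\<phi> ?m s) = \<phi> k s" using l kl(3) by simp
    ultimately show False using permutes_inj[OF perm[OF G(1)]] by (auto dest: injD)
  qed
  define U where "U s = (\<lambda>b. \<phi> b s) ` B" for s
  have U: "U s \<subseteq> {..<n}" if "s < n" for s
  proof
    fix x assume "x \<in> U s"
    then obtain b where b: "b \<in> B" "x = \<phi> b s" by (auto simp: U_def)
    then have "\<phi> b permutes {..<n}" using BG by (intro perm) auto
    then show "x \<in> {..<n}" using permutes_in_image[of "\<phi> b" "{..<n}" s] b that by simp
  qed
  have U0: "U s \<noteq> {}" "finite (U s)" for s using B by (auto simp: U_def)
  have Ug: "U (\<phi> g s) = (\<lambda>k. \<phi> k s) ` R g" if "good s" "g \<in> F" for g s
  proof -
    have "\<phi> (b \<otimes>\<^bsub>G\<^esub> g) s = \<phi> b (\<phi> g s)" if "b \<in> B" for b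
      using \<open>good s\<close> \<open>g \<in> F\<close> that by (auto simp: good_def N_def M_def)
    then show ?thesis unfolding U_def R_def image_image by (intro image_cong) auto
  qed
  define c where "c \<tau> s = Min (\<tau> ` U s)" for \<tau> :: "nat \<Rightarrow> nat" and s
  let ?P = "{\<tau>. \<tau> permutes {..<n}}"
  have finP: "finite ?P" by (simp add: finite_permutations)
  have P0: "?P \<noteq> {}" using permutes_id[of "{..<n}"] by blast
  \<comment> \<open>Equal minima come from a common point of the two sets, because \<tau> is
    injective. Injectivity of the orbit map lifts it to an equation
    \<open>b = b' \<otimes> g\<close> with both factors from \<open>B\<close> in \<open>H\<close>,
    which puts \<open>g\<close> into \<open>H\<close>.\<close>
  have moves: "c \<tau> (\<phi> g s) \<noteq> c \<tau> s" if asm: "good s" "g \<in> F" "g \<notin> H" "\<tau> permutes {..<n}" for g s \<tau>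
  proof
    assume eq: "c \<tau> (\<phi> g s) = c \<tau> s"
    have "c \<tau> s \<in> \<tau> ` U s" "c \<tau> (\<phi> g s) \<in> \<tau> ` U (\<phi> g s)"
      unfolding c_def using U0 by (auto intro!: Min_in)
    then obtain u where u: "u \<in> U s" "u \<in> U (\<phi> g s)"
      using eq permutes_inj[OF asm(4)] by (metis imageE injD)
    then obtain b k where bk: "b \<in> B" "k \<in> R g" "\<phi> b s = \<phi> k s"
      unfolding Ug[OF asm(1,2)] by (auto simp: U_def)
    then have "b = k" using inj_onD[OF inj[OF asm(1)] bk(3)] asm(2) by (auto simp: M_def)
    then obtain b' where b': "b' \<in> B" "b = b' \<otimes>\<^bsub>G\<^esub> g" using bk(2) by (auto simp: R_def)
    have gG: "g \<in> carrier G" "b' \<in> carrier G" using asm F b' BG by auto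
    have "?inv b' \<otimes>\<^bsub>G\<^esub> b \<in> H" using B b' bk by auto
    then show False using b' gG asm by (simp add: m_assoc[symmetric])
  qed
  \<comment> \<open>The orbit map carries the symmetric difference of \<open>B\<close> and
    \<open>R h\<close> onto that of the two sets whose minima are compared, and their union has at
    least \<open>card B\<close> points. The Foelner estimate thus bounds the proportion of bad
    orderings.\<close>
  have stays: "mostly ?P d (\<lambda>\<tau>. c \<tau> (\<phi> h s) = c \<tau> s)" if "good s" "h \<in> F \<inter> H" "s < n" for h s
  proof -
    let ?V = "U (\<phi> h s)" and ?bad = "{\<tau>. \<tau> permutes {..<n} \<and> Min (\<tau> ` U s) \<noteq> Min (\<tau> ` U (\<phi> h s))}"
    have hG: "h \<in> carrier G" using that F by auto
    have hF: "h \<in> F" using that by simp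
    have "\<phi> h s < n" using permutes_in_image[OF perm[OF hG], of s] that(3) by simp
    then have V: "?V \<subseteq> {..<n}" by (rule U)
    have sub: "B \<subseteq> M" "R h \<subseteq> M" using hF by (auto simp: M_def)
    have UV: "U s = (\<lambda>k. \<phi> k s) ` B" "?V = (\<lambda>k. \<phi> k s) ` R h"
      using Ug[OF that(1) hF] by (simp_all add: U_def)
    have "(U s - ?V) \<union> (?V - U s) = (\<lambda>k. \<phi> k s) ` ((B - R h) \<union> (R h - B))"
      unfolding UV image_Un
      using inj_on_image_set_diff[OF inj[OF that(1)], of B "R h"]
        inj_on_image_set_diff[OF inj[OF that(1)], of "R h" B] sub by blast
    then have diff: "card ((U s - ?V) \<union> (?V - U s)) \<le> card ((B - R h) \<union> (R h - B))"
      using B(2) by (auto intro!: card_image_le simp: R_def)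
    have "card B = card (U s)"
      unfolding UV(1) by (rule card_image[symmetric, OF inj_on_subset[OF inj[OF that(1)] sub(1)]])
    also have "\<dots> \<le> card (U s \<union> ?V)" using U0 by (intro card_mono) auto
    finally have "card ?bad * card B \<le> card ?bad * card (U s \<union> ?V)" by simp
    also have "\<dots> \<le> card ((U s - ?V) \<union> (?V - U s)) * card ?P"
      using U[OF that(3)] V U0 by (intro card_permutes_Min_neq) auto
    also have "\<dots> \<le> card ((B - R h) \<union> (R h - B)) * card ?P" using diff by simp
    finally have "real (card ?bad) * real (card B) \<le> real (card ((B - R h) \<union> (R h - B))) * real (card ?P)"
      by (simp only: of_nat_mult[symmetric] of_nat_le_iff)
    also have "\<dots> \<le> d * real (card B) * real (card ?P)"
      using cardR[OF that(2)] by (intro mult_right_mono) auto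
    finally have "real (card ?bad) * real (card B) \<le> (d * real (card ?P)) * real (card B)"
      by (simp add: mult_ac)
    moreover have "real (card B) > 0" using B by (simp add: card_gt_0_iff)
    ultimately have "real (card ?bad) \<le> d * real (card ?P)" by (simp only: mult_le_cancel_right_pos)
    moreover have "{\<tau> \<in> ?P. c \<tau> (\<phi> h s) \<noteq> c \<tau> s} = ?bad" by (auto simp: c_def)
    ultimately show ?thesis by (simp add: mostly_def)
  qed
  \<comment> \<open>For each fixed point most orderings are favourable; counting pairs then yields
    one ordering that is favourable for most points.\<close>
  have "mostly (?P \<times> {..<n}) (e/2)
    (\<lambda>p. good (snd p) \<longrightarrow> (\<forall>h\<in>F \<inter> H. c (fst p) (\<phi> h (snd p)) = c (fst p) (snd p)))"
  proof (rule mostly_Times_fiberwise[OF finP])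
    fix s assume s: "s \<in> {..<n}"
    have "mostly ?P (real (card (F \<inter> H)) * d) (\<lambda>\<tau>. \<forall>h\<in>F \<inter> H. good s \<longrightarrow> c \<tau> (\<phi> h s) = c \<tau> s)"
    proof (rule mostly_ball)
      fix h assume h: "h \<in> F \<inter> H"
      show "mostly ?P d (\<lambda>\<tau>. good s \<longrightarrow> c \<tau> (\<phi> h s) = c \<tau> s)"
        using stays[OF _ h, of s] s d by (cases "good s") (auto simp: mostly_def)
    qed (use F finP in auto)
    then show "mostly ?P (e/2) (\<lambda>\<tau>. good (snd (\<tau>, s)) \<longrightarrow>
        (\<forall>h\<in>F \<inter> H. c (fst (\<tau>, s)) (\<phi> h (snd (\<tau>, s))) = c (fst (\<tau>, s)) (snd (\<tau>, s))))"
      by (rule mostly_mono) (use finP Fd in auto)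
  qed simp
  from mostly_Times_ex_fiber[OF finP _ P0 this]
  obtain \<tau> where \<tau>: "\<tau> permutes {..<n}"
    and m\<tau>: "mostly {..<n} (e/2) (\<lambda>s. good s \<longrightarrow> (\<forall>h\<in>F \<inter> H. c \<tau> (\<phi> h s) = c \<tau> s))"
    by auto
  have "mostly {..<n} (e/2 + e/2) (\<lambda>s. good s \<and> (good s \<longrightarrow> (\<forall>h\<in>F \<inter> H. c \<tau> (\<phi> h s) = c \<tau> s)))"
    using most m\<tau> unfolding good_def[symmetric] by (intro mostly_conj) auto
  then have "mostly {..<n} e (good_point G H F \<phi> (c \<tau>))"
  proof (rule mostly_mono)
    fix s assume "good s \<and> (good s \<longrightarrow> (\<forall>h\<in>F \<inter> H. c \<tau> (\<phi> h s) = c \<tau> s))"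
    moreover have "F \<subseteq> N" by (auto simp: N_def M_def)
    ultimately show "good_point G H F \<phi> (c \<tau>) s"
      using moves[OF _ _ _ \<tau>, of s] unfolding good_point_def good_def by blast
  qed auto
  then have "rel_approx G H F e {..<n} \<phi> (c \<tau>)"
    using n perm by (auto simp: rel_approx_def permutes_imp_bij)
  then show ?thesis by blast
qed

text \<open>The colouring ignores the second coordinate, so the factor \<open>K\<close> preserves
  it. A nontrivial pair has a nontrivial component, which moves its own coordinate.\<close>

lemma rel_approx_DirProd:
  fixes Z :: "'z set"
  assumes "sofic K" "finite F" "F \<subseteq> carrier (G \<times>\<times> K)" "e > 0"
    "rel_approx G H (fst ` F) (e/2) Z \<phi> c"
  shows "\<exists>(Z' :: ('z \<times> nat) set) \<psi> c'. rel_approx (G \<times>\<times> K) (H \<times> carrier K) F e Z' \<psi> c'"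
proof -
  have sndF: "snd ` F \<subseteq> carrier K" using assms(3) by (auto simp: DirProd_def)
  obtain n :: nat and \<psi> where n: "n > 0" and perm: "\<And>g. g \<in> carrier K \<Longrightarrow> \<psi> g permutes {..<n}"
    and most: "mostly {..<n} (e/2) (\<lambda>s. (\<forall>g\<in>snd ` F. \<forall>h\<in>snd ` F. \<psi> (g \<otimes>\<^bsub>K\<^esub> h) s = \<psi> g (\<psi> h s)) \<and>
        (\<forall>g\<in>snd ` F. g \<noteq> \<one>\<^bsub>K\<^esub> \<longrightarrow> \<psi> g s \<noteq> s))"
    using soficE[OF assms(1) finite_imageI[OF assms(2)] sndF half_gt_zero[OF assms(4)]] by blast
  let ?\<psi> = "\<lambda>g. map_prod (\<phi> (fst g)) (\<psi> (snd g))"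
  have "mostly (Z \<times> {..<n}) (e/2 + e/2) (\<lambda>z. good_point G H (fst ` F) \<phi> c (fst z) \<and>
      ((\<forall>g\<in>snd ` F. \<forall>h\<in>snd ` F. \<psi> (g \<otimes>\<^bsub>K\<^esub> h) (snd z) = \<psi> g (\<psi> h (snd z))) \<and>
        (\<forall>g\<in>snd ` F. g \<noteq> \<one>\<^bsub>K\<^esub> \<longrightarrow> \<psi> g (snd z) \<noteq> snd z)))"
    using assms(5) most
    by (intro mostly_conj mostly_Times_fst[where P = "good_point G H (fst ` F) \<phi> c"]
        mostly_Times_snd[where P = "\<lambda>s. (\<forall>g\<in>snd ` F. \<forall>h\<in>snd ` F. \<psi> (g \<otimes>\<^bsub>K\<^esub> h) s = \<psi> g (\<psi> h s)) \<and>
        (\<forall>g\<in>snd ` F. g \<noteq> \<one>\<^bsub>K\<^esub> \<longrightarrow> \<psi> g s \<noteq> s)"]) (auto simp: rel_approx_def)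
  then have "mostly (Z \<times> {..<n}) e (good_point (G \<times>\<times> K) (H \<times> carrier K) F ?\<psi> (c \<circ> fst))"
  proof (rule mostly_mono)
    fix z
    assume z: "good_point G H (fst ` F) \<phi> c (fst z) \<and>
      ((\<forall>g\<in>snd ` F. \<forall>h\<in>snd ` F. \<psi> (g \<otimes>\<^bsub>K\<^esub> h) (snd z) = \<psi> g (\<psi> h (snd z))) \<and>
        (\<forall>g\<in>snd ` F. g \<noteq> \<one>\<^bsub>K\<^esub> \<longrightarrow> \<psi> g (snd z) \<noteq> snd z))"
    show "good_point (G \<times>\<times> K) (H \<times> carrier K) F ?\<psi> (c \<circ> fst) z"
      unfolding good_point_def
    proof (intro conjI ballI impI)
      fix g assume g: "g \<in> F"
      show "?\<psi> (g \<otimes>\<^bsub>G \<times>\<times> K\<^esub> h) z = ?\<psi> g (?\<psi> h z)" if "h \<in> F" for h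
        using z g that by (simp add: good_point_def DirProd_def case_prod_beta prod_eq_iff)
      show "?\<psi> g z \<noteq> z" if "g \<noteq> \<one>\<^bsub>G \<times>\<times> K\<^esub>"
        using z g that by (auto simp: good_point_def prod_eq_iff DirProd_def)
      show "(c \<circ> fst) (?\<psi> g z) = (c \<circ> fst) z \<longleftrightarrow> g \<in> H \<times> carrier K"
        using z g sndF by (auto simp: good_point_def mem_Times_iff)
    qed
  qed (use assms(5) in \<open>auto simp: rel_approx_def\<close>)
  moreover have "bij_betw (?\<psi> g) (Z \<times> {..<n}) (Z \<times> {..<n})" if "g \<in> carrier (G \<times>\<times> K)" for g
    using that assms(5) perm
    by (intro bij_betw_map_prod) (auto simp: rel_approx_def DirProd_def permutes_imp_bij)
  ultimately have "rel_approx (G \<times>\<times> K) (H \<times> carrier K) F e (Z \<times> {..<n}) ?\<psi> (c \<circ> fst)"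
    using assms(5) n by (auto simp: rel_approx_def)
  then show ?thesis by blast
qed

text \<open>The map \<theta> has to resemble an embedding only on \<open>F\<close>. This is what a
  single coordinate of representatives in an ultraproduct provides.\<close>

lemma rel_approx_pullback:
  assumes "rel_approx L S (\<theta> ` F) e Z \<phi> c"
    and "\<And>g. g \<in> carrier G \<Longrightarrow> \<theta> g \<in> carrier L"
    and "\<And>g h. g \<in> F \<Longrightarrow> h \<in> F \<Longrightarrow> \<theta> (g \<otimes>\<^bsub>G\<^esub> h) = \<theta> g \<otimes>\<^bsub>L\<^esub> \<theta> h"
    and "\<And>g. g \<in> F \<Longrightarrow> g \<noteq> \<one>\<^bsub>G\<^esub> \<Longrightarrow> \<theta> g \<noteq> \<one>\<^bsub>L\<^esub>"
    and "\<And>g. g \<in> F \<Longrightarrow> \<theta> g \<in> S \<longleftrightarrow> g \<in> H"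
  shows "rel_approx G H F e Z (\<lambda>g. \<phi> (\<theta> g)) c"
proof -
  have "mostly Z e (good_point G H F (\<lambda>g. \<phi> (\<theta> g)) c)"
    by (rule mostly_mono[where P = "good_point L S (\<theta> ` F) \<phi> c" and e = e])
       (use assms in \<open>auto simp: rel_approx_def good_point_def\<close>)
  then show ?thesis
    using assms(1,2) by (auto simp: rel_approx_def)
qed

subsection \<open>Ultraproducts\<close>

lemma group_ProdGroups:
  assumes "\<And>i. group (L i)"
  shows "group (ProdGroups L)"
proof (rule groupI)
  note monoid = group.is_monoid[OF assms]
  let ?P = "ProdGroups L"
  show "x \<otimes>\<^bsub>?P\<^esub> y \<in> carrier ?P" if "x \<in> carrier ?P" "y \<in> carrier ?P" for x y
    using that by (simp add: ProdGroups_def monoid.m_closed[OF monoid])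
  show "\<one>\<^bsub>?P\<^esub> \<in> carrier ?P"
    by (simp add: ProdGroups_def monoid.one_closed[OF monoid])
  show "x \<otimes>\<^bsub>?P\<^esub> y \<otimes>\<^bsub>?P\<^esub> z = x \<otimes>\<^bsub>?P\<^esub> (y \<otimes>\<^bsub>?P\<^esub> z)"
    if "x \<in> carrier ?P" "y \<in> carrier ?P" "z \<in> carrier ?P" for x y z
    using that by (simp add: ProdGroups_def monoid.m_assoc[OF monoid])
  show "\<one>\<^bsub>?P\<^esub> \<otimes>\<^bsub>?P\<^esub> x = x" if "x \<in> carrier ?P" for x
    using that by (simp add: ProdGroups_def monoid.l_one[OF monoid])
  show "\<exists>y\<in>carrier ?P. y \<otimes>\<^bsub>?P\<^esub> x = \<one>\<^bsub>?P\<^esub>" if "x \<in> carrier ?P" for x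
    using that
    by (intro bexI[of _ "\<lambda>i. inv\<^bsub>L i\<^esub> x i"])
       (simp_all add: ProdGroups_def group.l_inv[OF assms] group.inv_closed[OF assms])
qed

lemma inv_ProdGroups:
  assumes "\<And>i. group (L i)" "f \<in> carrier (ProdGroups L)"
  shows "inv\<^bsub>ProdGroups L\<^esub> f = (\<lambda>i. inv\<^bsub>L i\<^esub> f i)"
proof (rule group.inv_equality[OF group_ProdGroups[OF assms(1)]])
  show "(\<lambda>i. inv\<^bsub>L i\<^esub> f i) \<otimes>\<^bsub>ProdGroups L\<^esub> f = \<one>\<^bsub>ProdGroups L\<^esub>"
    using assms(2) by (simp add: ProdGroups_def group.l_inv[OF assms(1)])
qed (use assms(2) in \<open>simp_all add: ProdGroups_def group.inv_closed[OF assms(1)]\<close>)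

lemma free_ultrafilter_superset:
  "free_ultrafilter \<omega> \<Longrightarrow> A \<in> \<omega> \<Longrightarrow> A \<subseteq> B \<Longrightarrow> B \<in> \<omega>"
  unfolding free_ultrafilter_def by metis

lemma free_ultrafilter_Int:
  "free_ultrafilter \<omega> \<Longrightarrow> A \<in> \<omega> \<Longrightarrow> B \<in> \<omega> \<Longrightarrow> A \<inter> B \<in> \<omega>"
  unfolding free_ultrafilter_def by metis

lemma free_ultrafilter_Collect_not:
  "free_ultrafilter \<omega> \<Longrightarrow> {i. P i} \<notin> \<omega> \<Longrightarrow> {i. \<not> P i} \<in> \<omega>"
  unfolding free_ultrafilter_def Collect_neg_eq by metis

lemma free_ultrafilter_ball:
  assumes "free_ultrafilter \<omega>" "finite F" "\<And>x. x \<in> F \<Longrightarrow> {i. P x i} \<in> \<omega>"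
  shows "{i. \<forall>x\<in>F. P x i} \<in> \<omega>"
  using assms(2,3)
proof (induction F)
  case empty
  then show ?case using assms(1) by (simp add: free_ultrafilter_def)
next
  case (insert x F)
  have "{i. \<forall>x\<in>insert x F. P x i} = {i. P x i} \<inter> {i. \<forall>x\<in>F. P x i}" by auto
  then show ?case using free_ultrafilter_Int[OF assms(1)] insert by auto
qed

lemma ultra_kernel_normal:
  assumes "\<And>i. group (L i)" "free_ultrafilter \<omega>"
  shows "ultra_kernel \<omega> L \<lhd> ProdGroups L"
proof -
  interpret P: group "ProdGroups L" using assms(1) by (rule group_ProdGroups)
  have sub: "subgroup (ultra_kernel \<omega> L) (ProdGroups L)"
  proof (rule P.subgroupI)
    show "ultra_kernel \<omega> L \<noteq> {}"
      using P.one_closed assms(2)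
      by (auto simp: ultra_kernel_def ProdGroups_def free_ultrafilter_def intro!: exI[of _ "\<lambda>i. \<one>\<^bsub>L i\<^esub>"])
    show "inv\<^bsub>ProdGroups L\<^esub> f \<in> ultra_kernel \<omega> L" if f: "f \<in> ultra_kernel \<omega> L" for f
    proof -
      have "{i. (inv\<^bsub>ProdGroups L\<^esub> f) i = \<one>\<^bsub>L i\<^esub>} \<in> \<omega>"
        by (rule free_ultrafilter_superset[OF assms(2), of "{i. f i = \<one>\<^bsub>L i\<^esub>}"])
           (use f assms(1) in \<open>auto simp: ultra_kernel_def inv_ProdGroups monoid.inv_one group.is_monoid\<close>)
      then show ?thesis using f P.inv_closed by (simp add: ultra_kernel_def)
    qed
    show "f \<otimes>\<^bsub>ProdGroups L\<^esub> g \<in> ultra_kernel \<omega> L"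
      if f: "f \<in> ultra_kernel \<omega> L" and g: "g \<in> ultra_kernel \<omega> L" for f g
    proof -
      have "{i. (f \<otimes>\<^bsub>ProdGroups L\<^esub> g) i = \<one>\<^bsub>L i\<^esub>} \<in> \<omega>"
        by (rule free_ultrafilter_superset[OF assms(2)
              free_ultrafilter_Int[OF assms(2), of "{i. f i = \<one>\<^bsub>L i\<^esub>}" "{i. g i = \<one>\<^bsub>L i\<^esub>}"]])
           (use f g assms(1) in \<open>auto simp: ultra_kernel_def ProdGroups_def monoid.l_one monoid.one_closed group.is_monoid\<close>)
      then show ?thesis using f g P.m_closed by (simp add: ultra_kernel_def)
    qed
  qed (auto simp: ultra_kernel_def)
  moreover have "g \<otimes>\<^bsub>ProdGroups L\<^esub> f \<otimes>\<^bsub>ProdGroups L\<^esub> inv\<^bsub>ProdGroups L\<^esub> g \<in> ultra_kernel \<omega> L"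
    if g: "g \<in> carrier (ProdGroups L)" and f: "f \<in> ultra_kernel \<omega> L" for f g
  proof -
    have "{i. (g \<otimes>\<^bsub>ProdGroups L\<^esub> f \<otimes>\<^bsub>ProdGroups L\<^esub> inv\<^bsub>ProdGroups L\<^esub> g) i = \<one>\<^bsub>L i\<^esub>} \<in> \<omega>"
    proof (rule free_ultrafilter_superset[OF assms(2), of "{i. f i = \<one>\<^bsub>L i\<^esub>}"])
      show "{i. f i = \<one>\<^bsub>L i\<^esub>} \<subseteq> {i. (g \<otimes>\<^bsub>ProdGroups L\<^esub> f \<otimes>\<^bsub>ProdGroups L\<^esub> inv\<^bsub>ProdGroups L\<^esub> g) i = \<one>\<^bsub>L i\<^esub>}"
        unfolding inv_ProdGroups[OF assms(1) g]
        using g by (auto simp: ProdGroups_def monoid.r_one[OF group.is_monoid[OF assms(1)]] group.r_inv[OF assms(1)])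
    qed (use f in \<open>simp add: ultra_kernel_def\<close>)
    then show ?thesis using f g by (simp add: ultra_kernel_def)
  qed
  ultimately show ?thesis
    by (auto simp: P.normal_inv_iff)
qed

text \<open>Cosets agree when the quotient of their representatives lies in the kernel, which is a
  coordinatewise condition. Equations in the ultraproduct thereby become statements about the index
  sets in \<omega>.\<close>

lemma ultra_coset_eq_iff:
  assumes "\<And>i. group (L i)" "free_ultrafilter \<omega>"
    and f: "f \<in> carrier (ProdGroups L)" and g: "g \<in> carrier (ProdGroups L)"
  shows "ultra_kernel \<omega> L #>\<^bsub>ProdGroups L\<^esub> f = ultra_kernel \<omega> L #>\<^bsub>ProdGroups L\<^esub> g \<longleftrightarrow> {i. f i = g i} \<in> \<omega>"
proof -
  interpret P: group "ProdGroups L" using assms(1) by (rule group_ProdGroups)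
  interpret N: normal "ultra_kernel \<omega> L" "ProdGroups L" by (rule ultra_kernel_normal[OF assms(1,2)])
  let ?h = "f \<otimes>\<^bsub>ProdGroups L\<^esub> inv\<^bsub>ProdGroups L\<^esub> g"
  have "?h i = \<one>\<^bsub>L i\<^esub> \<longleftrightarrow> f i = g i" for i
  proof -
    interpret group "L i" by (rule assms(1))
    have "f i \<in> carrier (L i)" "g i \<in> carrier (L i)" using f g by (auto simp: ProdGroups_def)
    then have "f i \<otimes>\<^bsub>L i\<^esub> inv\<^bsub>L i\<^esub> g i = \<one>\<^bsub>L i\<^esub> \<longleftrightarrow> f i = g i"
      using right_cancel[of "inv\<^bsub>L i\<^esub> g i" "f i" "g i"] by simp
    moreover have "?h i = f i \<otimes>\<^bsub>L i\<^esub> inv\<^bsub>L i\<^esub> g i"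
      by (simp only: inv_ProdGroups[OF assms(1) g]) (simp add: ProdGroups_def)
    ultimately show ?thesis by simp
  qed
  then have "{i. ?h i = \<one>\<^bsub>L i\<^esub>} = {i. f i = g i}" by (simp only:)
  moreover have "?h \<in> carrier (ProdGroups L)" using f g by simp
  ultimately have "?h \<in> ultra_kernel \<omega> L \<longleftrightarrow> {i. f i = g i} \<in> \<omega>"
    by (simp only: ultra_kernel_def mem_Collect_eq simp_thms)
  moreover have "f \<in> ultra_kernel \<omega> L #>\<^bsub>ProdGroups L\<^esub> g \<longleftrightarrow> ?h \<in> ultra_kernel \<omega> L"
  proof
    assume "f \<in> ultra_kernel \<omega> L #>\<^bsub>ProdGroups L\<^esub> g"
    then show "?h \<in> ultra_kernel \<omega> L" using N.rcos_module_imp[OF P.group_axioms g] by simp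
  next
    assume "?h \<in> ultra_kernel \<omega> L"
    then show "f \<in> ultra_kernel \<omega> L #>\<^bsub>ProdGroups L\<^esub> g" using N.rcos_module_rev[OF P.group_axioms g f] by simp
  qed
  moreover have "ultra_kernel \<omega> L #>\<^bsub>ProdGroups L\<^esub> f = ultra_kernel \<omega> L #>\<^bsub>ProdGroups L\<^esub> g \<longleftrightarrow>
      f \<in> ultra_kernel \<omega> L #>\<^bsub>ProdGroups L\<^esub> g"
    using P.repr_independence[OF _ g N.subgroup_axioms] P.rcos_self[OF f N.subgroup_axioms] by metis
  ultimately show ?thesis by simp
qed

text \<open>Finitely many elements of \<open>G\<close> only involve a single factor of the ultraproduct, so no
  limit over the index set is needed.\<close>

lemma rel_approx_of_relatively_sofic:
  fixes G :: "('g, 'a) monoid_scheme" and K :: "('k, 'c) monoid_scheme"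
  assumes "group G" "subgroup H G" "sofic K" "relatively_sofic_over TYPE('x) G H K"
    and F: "finite F" "F \<subseteq> carrier G" and "e > 0"
  shows "\<exists>(Z :: (nat \<times> nat) set) \<phi> c. rel_approx G H F e Z \<phi> c"
proof -
  interpret group G by fact
  obtain Gs :: "nat \<Rightarrow> 'x monoid" and Hs \<omega> \<pi> where
    Gs: "\<And>i. sofic (Gs i)" "\<And>i. subgroup (Hs i) (Gs i)" "\<And>i. amenable ((Gs i)\<lparr>carrier := Hs i\<rparr>)"
    and \<omega>: "free_ultrafilter \<omega>"
    and \<pi>: "\<pi> \<in> hom G (ultraproduct \<omega> (\<lambda>i. Gs i \<times>\<times> K))" "inj_on \<pi> (carrier G)"
      "\<pi> ` carrier G \<inter> ultra_sub \<omega> (\<lambda>i. Gs i \<times>\<times> K) (\<lambda>i. Hs i \<times> carrier K) = \<pi> ` H"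
    using assms(4) unfolding relatively_sofic_over_def by (elim exE conjE) metis
  define L where "L i = Gs i \<times>\<times> K" for i
  define S where "S i = Hs i \<times> carrier K" for i
  define N where "N = ultra_kernel \<omega> L"
  let ?P = "ProdGroups L"
  have L: "group (L i)" for i
    unfolding L_def using Gs(1) assms(3) by (intro DirProd_group) (auto simp: sofic_def)
  have S: "S i \<subseteq> carrier (L i)" "\<one>\<^bsub>L i\<^esub> \<in> S i" for i
    using subgroup.subset[OF Gs(2)[of i]] subgroup.one_closed[OF Gs(2)[of i]] assms(3)
    by (auto simp: S_def L_def DirProd_def sofic_def group.is_monoid monoid.one_closed)
  interpret P: group ?P using L by (rule group_ProdGroups)
  interpret N: normal N ?P unfolding N_def by (rule ultra_kernel_normal[OF L \<omega>])
  have coset_eq: "N #>\<^bsub>?P\<^esub> f = N #>\<^bsub>?P\<^esub> g \<longleftrightarrow> {i. f i = g i} \<in> \<omega>"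
    if "f \<in> carrier ?P" "g \<in> carrier ?P" for f g
    unfolding N_def by (rule ultra_coset_eq_iff[OF L \<omega> that])
  have ultra: "ultraproduct \<omega> (\<lambda>i. Gs i \<times>\<times> K) = ?P Mod N"
    unfolding ultraproduct_def N_def L_def ..
  \<comment> \<open>Each image under \<pi> is lifted to a sequence; its coordinates
    \<open>\<theta> g i\<close> are the candidates for a local embedding into
    \<open>L i\<close>.\<close>
  have "\<exists>f\<in>carrier ?P. \<pi> g = N #>\<^bsub>?P\<^esub> f" if "g \<in> carrier G" for g
    using hom_in_carrier[OF \<pi>(1) that] unfolding ultra by (auto simp: FactGroup_def RCOSETS_def)
  then obtain \<theta> where \<theta>: "\<And>g. g \<in> carrier G \<Longrightarrow> \<theta> g \<in> carrier ?P"
    "\<And>g. g \<in> carrier G \<Longrightarrow> \<pi> g = N #>\<^bsub>?P\<^esub> \<theta> g" by metis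
  have mult: "{i. \<theta> (g \<otimes>\<^bsub>G\<^esub> h) i = \<theta> g i \<otimes>\<^bsub>L i\<^esub> \<theta> h i} \<in> \<omega>"
    if g: "g \<in> carrier G" and h: "h \<in> carrier G" for g h
  proof -
    have "N #>\<^bsub>?P\<^esub> \<theta> (g \<otimes>\<^bsub>G\<^esub> h) = \<pi> g \<otimes>\<^bsub>?P Mod N\<^esub> \<pi> h"
      using \<theta>(2)[of "g \<otimes>\<^bsub>G\<^esub> h"] hom_mult[OF \<pi>(1) g h] g h unfolding ultra by simp
    also have "\<dots> = N #>\<^bsub>?P\<^esub> (\<theta> g \<otimes>\<^bsub>?P\<^esub> \<theta> h)"
      using N.rcos_sum[OF \<theta>(1)[OF g] \<theta>(1)[OF h]] \<theta>(2) g h by (simp add: FactGroup_def)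
    finally have "{i. \<theta> (g \<otimes>\<^bsub>G\<^esub> h) i = (\<theta> g \<otimes>\<^bsub>?P\<^esub> \<theta> h) i} \<in> \<omega>"
      using coset_eq \<theta>(1) g h by simp
    then show ?thesis by (simp add: ProdGroups_def)
  qed
  \<comment> \<open>Wherever the lift is multiplicative at the identity, its value is idempotent in
    the group \<open>L i\<close> and hence trivial.\<close>
  have one: "{i. \<theta> \<one>\<^bsub>G\<^esub> i = \<one>\<^bsub>L i\<^esub>} \<in> \<omega>"
  proof (rule free_ultrafilter_superset[OF \<omega> mult[OF one_closed one_closed]])
    have "\<theta> \<one>\<^bsub>G\<^esub> i = \<one>\<^bsub>L i\<^esub>" if "\<theta> \<one>\<^bsub>G\<^esub> i = \<theta> \<one>\<^bsub>G\<^esub> i \<otimes>\<^bsub>L i\<^esub> \<theta> \<one>\<^bsub>G\<^esub> i" for i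
      using group.l_cancel_one'[OF L, of "\<theta> \<one>\<^bsub>G\<^esub> i" i "\<theta> \<one>\<^bsub>G\<^esub> i"] that \<theta>(1)[OF one_closed]
      by (simp add: ProdGroups_def)
    then show "{i. \<theta> (\<one>\<^bsub>G\<^esub> \<otimes>\<^bsub>G\<^esub> \<one>\<^bsub>G\<^esub>) i = \<theta> \<one>\<^bsub>G\<^esub> i \<otimes>\<^bsub>L i\<^esub> \<theta> \<one>\<^bsub>G\<^esub> i} \<subseteq> {i. \<theta> \<one>\<^bsub>G\<^esub> i = \<one>\<^bsub>L i\<^esub>}"
      by auto
  qed
  have free: "{i. \<theta> g i \<noteq> \<one>\<^bsub>L i\<^esub>} \<in> \<omega>" if g: "g \<in> carrier G" "g \<noteq> \<one>\<^bsub>G\<^esub>" for g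
  proof (rule free_ultrafilter_Collect_not[OF \<omega>], rule notI)
    assume "{i. \<theta> g i = \<one>\<^bsub>L i\<^esub>} \<in> \<omega>"
    then have "{i. \<theta> g i = \<theta> \<one>\<^bsub>G\<^esub> i} \<in> \<omega>"
      by (rule free_ultrafilter_superset[OF \<omega> free_ultrafilter_Int[OF \<omega> _ one]]) auto
    then have "\<pi> g = \<pi> \<one>\<^bsub>G\<^esub>" using coset_eq \<theta> g by simp
    then show False using inj_onD[OF \<pi>(2)] g by auto
  qed
  have mem: "{i. \<theta> g i \<in> S i \<longleftrightarrow> g \<in> H} \<in> \<omega>" if g: "g \<in> carrier G" for g
  proof (cases "g \<in> H")
    case True
    then have "\<pi> g \<in> ultra_sub \<omega> L S"
      using \<pi>(3) unfolding L_def[symmetric] S_def[symmetric] by blast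
    then obtain f where f: "\<And>i. f i \<in> S i" "\<pi> g = N #>\<^bsub>?P\<^esub> f"
      by (auto simp: ultra_sub_def N_def)
    have "f \<in> carrier ?P" using f(1) S by (auto simp: ProdGroups_def)
    then have "{i. \<theta> g i = f i} \<in> \<omega>" using f \<theta> g coset_eq by simp
    then show ?thesis
      by (rule free_ultrafilter_superset[OF \<omega>]) (use f True in auto)
  next
    case False
    have "{i. \<theta> g i \<in> S i} \<notin> \<omega>"
    proof
      assume a: "{i. \<theta> g i \<in> S i} \<in> \<omega>"
      \<comment> \<open>A sequence in \<open>ultra_sub\<close> must lie in \<open>S i\<close> at
        every index, so the lift is replaced by the identity at the others. Its coset does not
        change.\<close>
      define f where "f i = (if \<theta> g i \<in> S i then \<theta> g i else \<one>\<^bsub>L i\<^esub>)" for i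
      have fS: "f i \<in> S i" for i using S by (auto simp: f_def)
      then have "f \<in> carrier ?P" using S by (auto simp: ProdGroups_def)
      moreover have "{i. \<theta> g i = f i} \<in> \<omega>"
        by (rule free_ultrafilter_superset[OF \<omega> a]) (auto simp: f_def)
      ultimately have "\<pi> g = N #>\<^bsub>?P\<^esub> f" using \<theta> g coset_eq by simp
      then have "\<pi> g \<in> ultra_sub \<omega> L S" using fS by (auto simp: ultra_sub_def N_def)
      then have "\<pi> g \<in> \<pi> ` H" using \<pi>(3) g unfolding L_def[symmetric] S_def[symmetric] by blast
      then show False
        using inj_on_image_mem_iff[OF \<pi>(2) g subgroup.subset[OF assms(2)]] False by simp
    qed
    from free_ultrafilter_Collect_not[OF \<omega> this] show ?thesis using False by simp
  qed
  have 1: "{i. \<forall>p\<in>F \<times> F. \<theta> (fst p \<otimes>\<^bsub>G\<^esub> snd p) i = \<theta> (fst p) i \<otimes>\<^bsub>L i\<^esub> \<theta> (snd p) i} \<in> \<omega>"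
    by (intro free_ultrafilter_ball[OF \<omega>] mult) (use F in auto)
  have 2: "{i. \<forall>g\<in>F - {\<one>\<^bsub>G\<^esub>}. \<theta> g i \<noteq> \<one>\<^bsub>L i\<^esub>} \<in> \<omega>"
    by (intro free_ultrafilter_ball[OF \<omega>] free) (use F in auto)
  have 3: "{i. \<forall>g\<in>F. \<theta> g i \<in> S i \<longleftrightarrow> g \<in> H} \<in> \<omega>"
    by (intro free_ultrafilter_ball[OF \<omega>] mem) (use F in auto)
  \<comment> \<open>Members of the ultrafilter are nonempty, so some index satisfies all of the
    finitely many conditions imposed by \<open>F\<close>.\<close>
  have "A \<noteq> {}" if "A \<in> \<omega>" for A using \<omega> that by (auto simp only: free_ultrafilter_def)
  from this[OF free_ultrafilter_Int[OF \<omega> free_ultrafilter_Int[OF \<omega> 1 2] 3]]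
  obtain i where i: "\<forall>p\<in>F \<times> F. \<theta> (fst p \<otimes>\<^bsub>G\<^esub> snd p) i = \<theta> (fst p) i \<otimes>\<^bsub>L i\<^esub> \<theta> (snd p) i"
    "\<forall>g\<in>F - {\<one>\<^bsub>G\<^esub>}. \<theta> g i \<noteq> \<one>\<^bsub>L i\<^esub>" "\<forall>g\<in>F. \<theta> g i \<in> S i \<longleftrightarrow> g \<in> H"
    unfolding Int_Collect ex_in_conv[symmetric] mem_Collect_eq by blast
  let ?F = "(\<lambda>g. \<theta> g i) ` F"
  have \<theta>L: "\<theta> g i \<in> carrier (L i)" if "g \<in> carrier G" for g
    using \<theta>(1)[OF that] by (simp add: ProdGroups_def)
  have F': "finite ?F" "?F \<subseteq> carrier (Gs i \<times>\<times> K)"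
    using F(1) \<theta>L[OF subsetD[OF F(2)]] unfolding L_def by (blast intro: finite_imageI)+
  have "finite (fst ` ?F)" "fst ` ?F \<subseteq> carrier (Gs i)" using F' by (force simp: DirProd_def)+
  from amenable_rel_approx[OF Gs(1) Gs(2) Gs(3) this half_gt_zero[OF assms(7)]]
  obtain n :: nat and \<phi> c where "rel_approx (Gs i) (Hs i) (fst ` ?F) (e/2) {..<n} \<phi> c" by blast
  from rel_approx_DirProd[OF assms(3) F' assms(7) this]
  obtain Z :: "(nat \<times> nat) set" and \<psi> c' where a: "rel_approx (L i) (S i) ?F e Z \<psi> c'"
    by (auto simp: L_def S_def)
  have "rel_approx G H F e Z (\<lambda>g. \<psi> (\<theta> g i)) c'"
    by (rule rel_approx_pullback[where \<theta> = "\<lambda>g. \<theta> g i", OF a \<theta>L]) (use i in auto)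
  then show ?thesis by blast
qed

theorem theorem2p7:
  fixes G :: "('g, 'a) monoid_scheme" and H :: "'g set" and K :: "('k, 'c) monoid_scheme"
  assumes "group G" and "subgroup H G" and "sofic K"
    and "relatively_sofic_over TYPE('x) G H K"
  shows "sofic (amalg_free_product G H)"
  by (rule sofic_amalg_free_product[OF assms(1,2) rel_approx_of_relatively_sofic[OF assms]])

end
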